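(* For $t\in[0,1]$ define the following subsets of $\mathbb{R}^2$: $\Gamma_t^+$ is the closed line segment with endpoints $(-1,t)$ and $(1,1-t)$, $\Gamma_t^-$ is the closed line segment with endpoints $(-1,-t)$ and $(1,t-1)$, and $\Gamma_t=\Gamma_t^+\cup\Gamma_t^-$. Let $\mu_0$ and $\mu_1$ be the normalized arclength measures on $\Gamma_0$ and $\Gamma_1$ respectively, and let $(\mu_t)_{t\in[0,1]}$ be the displacement interpolation between them. Let $p\in[1,\infty)$. Then \[ \mathsf{C}_p(\mu_i)<\infty\quad\text{and}\quad\mathsf{T}_2(\mu_i)<\infty,\qquad i=0,1, \] whereas for every $0<t<1$, \[ \mathsf{C}_p(\mu_t)=\mathsf{T}_2(\mu_t)=\infty . \] Thus, in every dimension $n\geq 2$, the $L^p$-Poincaré inequality and the Talagrand $T_2$ inequality fail to propagate by displacement interpolation: finiteness of $\mathsf{C}_p$ (respectively $\mathsf{T}_2$) at both endpoint measures on $\mathbb{R}^n$ does not in general imply its finiteness at interior times of the displacement interpolation.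
   Context: The normalized arclength measure on a finite union $\Gamma$ of segments is the one-dimensional Hausdorff measure restricted to $\Gamma$, divided by the total length of $\Gamma$. A displacement interpolation between $\mu_0$ and $\mu_1$ is $\mu_t=\bigl((x,y)\mapsto(1-t)x+ty\bigr)_\#\pi$, $t\in[0,1]$, where $\pi$ is a quadratic optimal coupling, i.e. a minimizer of $\int|x-y|^2\,\mathrm{d}\pi$ among couplings of $\mu_0$ and $\mu_1$; for the two measures above, the quadratic optimal coupling is unique. Here $T_\#\pi$ denotes the image of $\pi$ under $T$. For a Borel probability measure $\mu$ on $\mathbb{R}^n$ and $1\leq p<\infty$, $\mathsf{C}_p(\mu)\in[0,+\infty]$ is the best (smallest) constant $C$ in \[ \inf_{a\in\mathbb{R}}\int|f-a|^p\,\mathrm{d}\mu\leq C\int|\nabla f|^p\,\mathrm{d}\mu \] for all $f\in C^1(\mathbb{R}^n)$ with $\nabla f\in C_c(\mathbb{R}^n;\mathbb{R}^n)$ (continuous with compact support); it is $+\infty$ if no finite constant works. $\mathsf{T}_2(\mu)\in[0,+\infty]$ is the best (smallest) constant $C$ such that $W_2^2(\mu,\nu)\leq C\,\mathrm{H}(\nu\mid\mu)$ for all Borel probability measures $\nu$ on $\mathbb{R}^n$ ($+\infty$ if none), where $W_2^2(\mu,\nu)=\inf_{\pi}\int|x-y|^2\,\mathrm{d}\pi(x,y)\in[0,+\infty]$ over couplings $\pi$ of $\mu$ and $\nu$, and $\mathrm{H}(\nu\mid\mu)=\int\log\left(\frac{\mathrm{d}\nu}{\mathrm{d}\mu}\right)\mathrm{d}\nu$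 if $\nu\ll\mu$, $+\infty$ otherwise. *)

theory Defs
  imports "HOL-Probability.Probability"
begin

text \<open>
  One-dimensional Hausdorff measure. The covering sets are required to be bounded because
  \<^const>\<open>diameter\<close> is real-valued and unspecified on unbounded sets; no normalising factor
  occurs in dimension one. The outer measure is a metric outer measure, hence countably additive on
  the Borel sets (otherwise \<^const>\<open>measure_of\<close> would yield the null measure).
\<close>

definition hausdorff1_pre :: "real \<Rightarrow> 'a::metric_space set \<Rightarrow> ennreal" where
  "hausdorff1_pre \<delta> A =
     (INF U \<in> {U :: nat \<Rightarrow> 'a set. A \<subseteq> (\<Union>i. U i) \<and> (\<forall>i. bounded (U i) \<and> diameter (U i) \<le> \<delta>)}.
        \<Sum>i. ennreal (diameter (U i)))"

definition hausdorff1_outer :: "'a::metric_space set \<Rightarrow> ennreal" where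
  "hausdorff1_outer A = (SUP \<delta> \<in> {0<..}. hausdorff1_pre \<delta> A)"

definition hausdorff1 :: "'a::metric_space measure" where
  "hausdorff1 = measure_of UNIV (sets borel) hausdorff1_outer"

definition arclength_measure :: "'a::metric_space set \<Rightarrow> 'a measure" where
  "arclength_measure \<Gamma> = uniform_measure hausdorff1 \<Gamma>"

definition coupling ::
    "'a::euclidean_space measure \<Rightarrow> 'a measure \<Rightarrow> ('a \<times> 'a) measure \<Rightarrow> bool" where
  "coupling \<mu> \<nu> \<pi> \<longleftrightarrow>
     sets \<pi> = sets borel \<and> distr \<pi> borel fst = \<mu> \<and> distr \<pi> borel snd = \<nu>"

definition quadratic_cost :: "('a::euclidean_space \<times> 'a) measure \<Rightarrow> ennreal" where
  "quadratic_cost \<pi> = (\<integral>\<^sup>+ (x, y). ennreal ((norm (x - y))\<^sup>2) \<partial>\<pi>)"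

definition optimal_coupling ::
    "'a::euclidean_space measure \<Rightarrow> 'a measure \<Rightarrow> ('a \<times> 'a) measure \<Rightarrow> bool" where
  "optimal_coupling \<mu> \<nu> \<pi> \<longleftrightarrow>
     coupling \<mu> \<nu> \<pi> \<and> (\<forall>\<pi>'. coupling \<mu> \<nu> \<pi>' \<longrightarrow> quadratic_cost \<pi> \<le> quadratic_cost \<pi>')"

definition W2_squared :: "'a::euclidean_space measure \<Rightarrow> 'a measure \<Rightarrow> ennreal" where
  "W2_squared \<mu> \<nu> = (INF \<pi> \<in> Collect (coupling \<mu> \<nu>). quadratic_cost \<pi>)"

text \<open>Only the values at times in \<open>[0,1]\<close> of the curve \<open>\<mu>\<close> are constrained.\<close>

definition displacement_interpolation ::
    "'a::euclidean_space measure \<Rightarrow> 'a measure \<Rightarrow> (real \<Rightarrow> 'a measure) \<Rightarrow> bool" where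
  "displacement_interpolation \<mu>0 \<mu>1 \<mu> \<longleftrightarrow>
     (\<exists>\<pi>. optimal_coupling \<mu>0 \<mu>1 \<pi> \<and>
        (\<forall>t\<in>{0..1}. \<mu> t = distr \<pi> borel (\<lambda>(x, y). (1 - t) *\<^sub>R x + t *\<^sub>R y)))"

text \<open>
  \<open>f\<close> is continuously differentiable with gradient \<open>g\<close>, and \<open>g\<close> has compact support.
\<close>

definition poincare_test :: "('a::euclidean_space \<Rightarrow> real) \<Rightarrow> ('a \<Rightarrow> 'a) \<Rightarrow> bool" where
  "poincare_test f g \<longleftrightarrow>
     (\<forall>x. GDERIV f x :> g x) \<and> continuous_on UNIV g \<and> compact (closure {x. g x \<noteq> 0})"

text \<open>
  In both best constants below, the infimum of the empty set is \<open>\<top>\<close>. Whether \<open>C = \<top>\<close> is itself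
  admissible (given \<open>\<top> * 0 = 0\<close> in \<^typ>\<open>ennreal\<close>) does not affect the infimum, and neither does
  the convention \<open>0 * \<top> = 0\<close>, which matters only at \<open>C = 0\<close>, in the transport inequality.
\<close>

definition poincare_const :: "real \<Rightarrow> 'a::euclidean_space measure \<Rightarrow> ennreal" where
  "poincare_const p \<mu> =
     Inf {C. \<forall>f g. poincare_test f g \<longrightarrow>
        (INF a::real. \<integral>\<^sup>+x. ennreal (\<bar>f x - a\<bar> powr p) \<partial>\<mu>)
          \<le> C * (\<integral>\<^sup>+x. ennreal (norm (g x) powr p) \<partial>\<mu>)}"

text \<open>
  For probability measures with \<open>\<nu>\<close> absolutely continuous with respect to \<open>\<mu>\<close> the negative part of \<open>log (d\<nu>/d\<mu>)\<close> is always
  \<open>\<nu>\<close>-integrable, so non-integrability means that the entropy integral is \<open>+\<infinity>\<close> (whereas the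
  Bochner integral in \<^const>\<open>KL_divergence\<close> would then be \<open>0\<close>). The entropy is never negative,
  so \<^const>\<open>ennreal\<close> does not truncate.
\<close>

definition rel_entropy :: "'a measure \<Rightarrow> 'a measure \<Rightarrow> ennreal" where
  "rel_entropy \<nu> \<mu> =
     (if absolutely_continuous \<mu> \<nu> \<and> integrable \<nu> (entropy_density (exp 1) \<mu> \<nu>)
      then ennreal (KL_divergence (exp 1) \<mu> \<nu>) else \<top>)"

definition talagrand_const :: "'a::euclidean_space measure \<Rightarrow> ennreal" where
  "talagrand_const \<mu> =
     Inf {C. \<forall>\<nu>. prob_space \<nu> \<and> sets \<nu> = sets borel \<longrightarrow> W2_squared \<mu> \<nu> \<le> C * rel_entropy \<nu> \<mu>}"

definition Gamma_plus :: "real \<Rightarrow> (real^2) set" where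
  "Gamma_plus t = closed_segment (vector [-1, t]) (vector [1, 1 - t])"

definition Gamma_minus :: "real \<Rightarrow> (real^2) set" where
  "Gamma_minus t = closed_segment (vector [-1, - t]) (vector [1, t - 1])"

definition Gamma_union :: "real \<Rightarrow> (real^2) set" where
  "Gamma_union t = Gamma_plus t \<union> Gamma_minus t"

end

theory Submission
  imports Defs
begin

text \<open>
  Both endpoint measures are images of the uniform measure on \<open>[-1,1]\<close> under a Lipschitz curve, a
  \<open>V\<close> traversed with constant speed. This gives the Poincare inequality by integrating the gradient
  from the vertex, and the \<open>T\<^sub>2\<close> inequality by pushing forward that of the uniform measure.
  If \<open>x\<close> and \<open>y\<close> lie on the two supports, then \<open>\<bar>x\<^sub>2\<bar> = (1 + x\<^sub>1)/2\<close> and \<open>\<bar>y\<^sub>2\<bar> = (1 - y\<^sub>1)/2\<close>, so that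
  \<open>(norm (x - y))\<^sup>2 \<ge> (x\<^sub>1 - y\<^sub>1)\<^sup>2 + (x\<^sub>1 + y\<^sub>1)\<^sup>2/4 \<ge> (x\<^sub>1\<^sup>2 + y\<^sub>1\<^sup>2)/2\<close>, with equality only if \<open>x\<^sub>1 = y\<^sub>1\<close>
  and \<open>x\<^sub>2 y\<^sub>2 \<ge> 0\<close>. Integrating, the optimal coupling is the vertical shift within each branch, and
  at interior times the two branches are disjoint segments. A test function that is locally
  constant on them then violates the Poincare inequality, and moving a small mass \<open>\<epsilon>\<close> from one
  segment to the other costs order \<open>\<epsilon>\<close> in transport but only \<open>\<epsilon>\<^sup>2\<close> in entropy.
\<close>

section \<open>One-dimensional Hausdorff measure of segments\<close>

text \<open>Why one pointwise inequality settles optimality: its lower bound is a function of x plus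
  a function of y, so its integral is fixed by the marginals and is the same finite number for all
  couplings. It is a dual certificate, attained by the shift; conversely any minimiser must satisfy
  the equality case almost everywhere, which puts it on the graph of one map. Uniqueness in turn
  determines the interior measures of every displacement interpolation. On both curves the parameter
  \<open>u\<close> in [-1,1] is the second coordinate. In this parameter the vertical shift is
  \<open>reflect u = sgn u - u\<close>: it preserves the uniform measure but jumps at 0, and this
  jump is what tears the two branches apart for 0 < t < 1. Two orthonormal vectors of an arbitrary
  Euclidean space replace the coordinates of the plane, so the planar statement and the examples in
  dimension n are instances of one argument. The link to the given definitions is the measure
  \<open>hausdorff1\<close>, which must be shown to be a measure and computed on segments before
  anything else.\<close>

lemma hausdorff1_pre_le:
  assumes "A \<subseteq> (\<Union>i. U i)" "\<And>i. bounded (U i)" "\<And>i. diameter (U i) \<le> \<delta>"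
  shows "hausdorff1_pre \<delta> A \<le> (\<Sum>i. ennreal (diameter (U i)))"
  unfolding hausdorff1_pre_def using assms by (intro INF_lower) auto

lemma hausdorff1_pre_greatest:
  assumes "\<And>U. A \<subseteq> (\<Union>i. U i) \<Longrightarrow> (\<And>i. bounded (U i)) \<Longrightarrow> (\<And>i. diameter (U i) \<le> \<delta>) \<Longrightarrow>
     z \<le> (\<Sum>i. ennreal (diameter (U i)))"
  shows "z \<le> hausdorff1_pre \<delta> A"
  unfolding hausdorff1_pre_def using assms by (intro INF_greatest) auto

lemma hausdorff1_pre_antimono: "\<delta> \<le> \<epsilon> \<Longrightarrow> hausdorff1_pre \<epsilon> A \<le> hausdorff1_pre \<delta> A"
  by (rule hausdorff1_pre_greatest, rule hausdorff1_pre_le) (auto intro: order_trans)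

lemma hausdorff1_pre_mono: "A \<subseteq> B \<Longrightarrow> hausdorff1_pre \<delta> A \<le> hausdorff1_pre \<delta> B"
  by (rule hausdorff1_pre_greatest, rule hausdorff1_pre_le) auto

lemma hausdorff1_pre_le_outer: "0 < \<delta> \<Longrightarrow> hausdorff1_pre \<delta> A \<le> hausdorff1_outer A"
  unfolding hausdorff1_outer_def by (intro SUP_upper) auto

lemma hausdorff1_outer_mono: "A \<subseteq> B \<Longrightarrow> hausdorff1_outer A \<le> hausdorff1_outer B"
  unfolding hausdorff1_outer_def by (intro SUP_mono) (auto intro: hausdorff1_pre_mono)

lemma hausdorff1_outer_empty [simp]: "hausdorff1_outer {} = 0"
proof -
  have "hausdorff1_pre \<delta> ({} :: 'a set) \<le> 0" if "\<delta> > 0" for \<delta>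
    using hausdorff1_pre_le[of "{}" "\<lambda>_. {} :: 'a set" \<delta>] that by (simp add: diameter_empty)
  then show ?thesis by (simp add: hausdorff1_outer_def)
qed

text \<open>Covers of the \<open>A n\<close> that are optimal up to e/2^(n+1) are merged into a
  single sequence by \<open>prod_decode\<close>; the errors add up to e. Finiteness of the sum makes
  such near-optimal covers available.\<close>

lemma hausdorff1_pre_countably_subadditive:
  "hausdorff1_pre \<delta> (\<Union>n. A n) \<le> (\<Sum>n. hausdorff1_pre \<delta> (A n :: 'a::metric_space set))"
proof (rule ennreal_le_epsilon)
  fix e :: real assume e: "0 < e" and fin: "(\<Sum>n. hausdorff1_pre \<delta> (A n)) < \<top>"
  have finA: "hausdorff1_pre \<delta> (A n) < \<top>" for n
    using fin ennreal_suminf_lessD by blast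
  have "\<exists>U. A n \<subseteq> (\<Union>i. U i) \<and> (\<forall>i. bounded (U i) \<and> diameter (U i) \<le> \<delta>) \<and>
      (\<Sum>i. ennreal (diameter (U i))) \<le> hausdorff1_pre \<delta> (A n) + ennreal (e * (1/2)^Suc n)" for n
  proof -
    have "hausdorff1_pre \<delta> (A n) < hausdorff1_pre \<delta> (A n) + ennreal (e * (1/2)^Suc n)"
      using e finA[of n] by (cases "hausdorff1_pre \<delta> (A n)") (auto simp: ennreal_less_iff simp flip: ennreal_plus)
    then show ?thesis
      unfolding hausdorff1_pre_def INF_less_iff by (auto intro: less_imp_le)
  qed
  then obtain U where U: "\<And>n. A n \<subseteq> (\<Union>i. U n i)" "\<And>n i. bounded (U n i)" "\<And>n i. diameter (U n i) \<le> \<delta>"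
    "\<And>n. (\<Sum>i. ennreal (diameter (U n i))) \<le> hausdorff1_pre \<delta> (A n) + ennreal (e * (1/2)^Suc n)"
    by metis
  define V where "V k = (case prod_decode k of (n, i) \<Rightarrow> U n i)" for k
  have "hausdorff1_pre \<delta> (\<Union>n. A n) \<le> (\<Sum>k. ennreal (diameter (V k)))"
  proof (rule hausdorff1_pre_le)
    show "(\<Union>n. A n) \<subseteq> (\<Union>k. V k)"
    proof clarify
      fix x n assume "x \<in> A n"
      then obtain i where "x \<in> U n i" using U(1) by blast
      then show "x \<in> (\<Union>k. V k)"
        by (intro UN_I[of "prod_encode (n, i)"]) (auto simp: V_def)
    qed
  qed (auto simp: V_def U split: prod.split)
  also have "\<dots> = (\<Sum>n. \<Sum>i. ennreal (diameter (U n i)))"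
    using suminf_ennreal_2dimen[of "\<lambda>n. \<Sum>i. ennreal (diameter (U n i))"
        "\<lambda>(n, i). ennreal (diameter (U n i))"]
    by (simp add: V_def comp_def case_prod_unfold)
  also have "\<dots> \<le> (\<Sum>n. hausdorff1_pre \<delta> (A n) + ennreal (e * (1/2)^Suc n))"
    by (intro suminf_le U) auto
  also have "\<dots> = (\<Sum>n. hausdorff1_pre \<delta> (A n)) + (\<Sum>n. ennreal (e * (1/2)^Suc n))"
    by (intro suminf_add[symmetric]) auto
  also have "(\<Sum>n. ennreal (e * (1/2)^Suc n)) = ennreal e"
    using sums_mult[OF power_half_series, of e] e by (intro suminf_ennreal_eq) auto
  finally show "hausdorff1_pre \<delta> (\<Union>n. A n) \<le> (\<Sum>n. hausdorff1_pre \<delta> (A n)) + ennreal e" .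
qed

lemma hausdorff1_outer_countably_subadditive:
  "hausdorff1_outer (\<Union>n. A n) \<le> (\<Sum>n. hausdorff1_outer (A n))"
  unfolding hausdorff1_outer_def[of "\<Union>n. A n"]
proof (rule SUP_least)
  fix \<delta> :: real assume "\<delta> \<in> {0<..}"
  then have "(\<Sum>n. hausdorff1_pre \<delta> (A n)) \<le> (\<Sum>n. hausdorff1_outer (A n))"
    by (intro suminf_le) (auto intro: hausdorff1_pre_le_outer)
  then show "hausdorff1_pre \<delta> (\<Union>n. A n) \<le> (\<Sum>n. hausdorff1_outer (A n))"
    using hausdorff1_pre_countably_subadditive order_trans by blast
qed

section \<open>Caratheodory measurability of the Borel sets\<close>

lemma outer_measure_space_hausdorff1:
  "outer_measure_space UNIV (hausdorff1_outer :: 'a::metric_space set \<Rightarrow> ennreal)"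
  unfolding outer_measure_space_def positive_def increasing_def countably_subadditive_def
  by (auto intro: hausdorff1_outer_mono hausdorff1_outer_countably_subadditive)

lemma hausdorff1_outer_Un_le: "hausdorff1_outer (A \<union> B) \<le> hausdorff1_outer A + hausdorff1_outer B"
proof -
  have "hausdorff1_outer (\<Union>n. binaryset A B n) \<le> (\<Sum>n. hausdorff1_outer (binaryset A B n))"
    by (rule hausdorff1_outer_countably_subadditive)
  then show ?thesis
    by (simp add: UN_binaryset_eq suminf_binaryset_eq)
qed

text \<open>A uniform gap instead of positivity of \<open>setdist\<close>, so that the empty set is
  separated from every set; the induction over the bands starts from an empty union.\<close>

definition separated_sets :: "'a::metric_space set \<Rightarrow> 'a set \<Rightarrow> bool" where
  "separated_sets A B \<longleftrightarrow> (\<exists>\<eta>>0. \<forall>a\<in>A. \<forall>b\<in>B. \<eta> \<le> dist a b)"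

text \<open>At scales below the distance between \<open>A\<close> and \<open>B\<close>, no covering set meets both.\<close>

lemma hausdorff1_outer_Un_separated:
  fixes A B :: "'a::metric_space set"
  assumes "separated_sets A B"
  shows "hausdorff1_outer (A \<union> B) = hausdorff1_outer A + hausdorff1_outer B"
proof (rule antisym[OF hausdorff1_outer_Un_le])
  from assms obtain \<eta> where \<eta>: "\<eta> > 0" "\<And>a b. a \<in> A \<Longrightarrow> b \<in> B \<Longrightarrow> \<eta> \<le> dist a b"
    unfolding separated_sets_def by auto
  have pre: "hausdorff1_pre \<delta> A + hausdorff1_pre \<delta> B \<le> hausdorff1_outer (A \<union> B)"
    if "0 < \<delta>" "\<delta> < \<eta>" for \<delta>
  proof -
    have "hausdorff1_pre \<delta> A + hausdorff1_pre \<delta> B \<le> hausdorff1_pre \<delta> (A \<union> B)"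
    proof (rule hausdorff1_pre_greatest)
      fix U :: "nat \<Rightarrow> 'a set"
      assume U: "A \<union> B \<subseteq> (\<Union>i. U i)" "\<And>i. bounded (U i)" "\<And>i. diameter (U i) \<le> \<delta>"
      define V where "V C i = (if U i \<inter> C \<noteq> {} then U i else {})" for C i
      have V: "hausdorff1_pre \<delta> C \<le> (\<Sum>i. ennreal (diameter (V C i)))" if "C \<subseteq> A \<union> B" for C
      proof (rule hausdorff1_pre_le)
        show "C \<subseteq> (\<Union>i. V C i)" using that U(1) unfolding V_def by fastforce
      qed (use U \<open>0 < \<delta>\<close> in \<open>auto simp: V_def diameter_empty\<close>)
      have disj: "U i \<inter> A = {} \<or> U i \<inter> B = {}" for i
      proof (rule ccontr)
        assume "\<not> ?thesis"
        then obtain a b where "a \<in> U i" "a \<in> A" "b \<in> U i" "b \<in> B" by auto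
        with diameter_bounded_bound[OF U(2)[of i]] U(3)[of i] \<eta>(2)[of a b] \<open>\<delta> < \<eta>\<close>
        show False by fastforce
      qed
      have "hausdorff1_pre \<delta> A + hausdorff1_pre \<delta> B
          \<le> (\<Sum>i. ennreal (diameter (V A i))) + (\<Sum>i. ennreal (diameter (V B i)))"
        by (intro add_mono V) auto
      also have "\<dots> = (\<Sum>i. ennreal (diameter (V A i)) + ennreal (diameter (V B i)))"
        by (intro suminf_add) auto
      also have "\<dots> \<le> (\<Sum>i. ennreal (diameter (U i)))"
        using disj by (intro suminf_le) (auto simp: V_def diameter_empty)
      finally show "hausdorff1_pre \<delta> A + hausdorff1_pre \<delta> B \<le> (\<Sum>i. ennreal (diameter (U i)))" .
    qed
    also have "\<dots> \<le> hausdorff1_outer (A \<union> B)" using that by (intro hausdorff1_pre_le_outer)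
    finally show ?thesis .
  qed
  \<comment> \<open>Both premeasures grow as the scale shrinks, so the sum of the suprema is the
    supremum of the sums at a common scale; that scale may then be taken below the gap.\<close>
  have "hausdorff1_outer A + hausdorff1_outer B =
      (SUP \<delta>\<in>{0<..}. hausdorff1_pre \<delta> A + hausdorff1_pre \<delta> B)"
    unfolding hausdorff1_outer_def
  proof (rule SUP_add_directed_ennreal[symmetric])
    fix \<delta> \<epsilon> :: real assume "\<delta> \<in> {0<..}" "\<epsilon> \<in> {0<..}"
    then show "\<exists>k\<in>{0<..}. hausdorff1_pre \<delta> A + hausdorff1_pre \<epsilon> B \<le> hausdorff1_pre k A + hausdorff1_pre k B"
      by (intro bexI[of _ "min \<delta> \<epsilon>"] add_mono hausdorff1_pre_antimono) auto
  qed 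
  also have "\<dots> \<le> hausdorff1_outer (A \<union> B)"
  proof (rule SUP_least)
    fix \<delta> :: real assume "\<delta> \<in> {0<..}"
    then have "hausdorff1_pre \<delta> A + hausdorff1_pre \<delta> B
        \<le> hausdorff1_pre (min \<delta> (\<eta>/2)) A + hausdorff1_pre (min \<delta> (\<eta>/2)) B"
      by (intro add_mono hausdorff1_pre_antimono) auto
    also have "\<dots> \<le> hausdorff1_outer (A \<union> B)"
      using \<open>\<delta> \<in> {0<..}\<close> \<eta>(1) by (intro pre) auto
    finally show "hausdorff1_pre \<delta> A + hausdorff1_pre \<delta> B \<le> hausdorff1_outer (A \<union> B)" .
  qed
  finally show "hausdorff1_outer A + hausdorff1_outer B \<le> hausdorff1_outer (A \<union> B)" .
qed

text \<open>The distance to \<open>F\<close> is 1-Lipschitz; all gaps between bands around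
  \<open>F\<close> come from this.\<close>

lemma infdist_gap_le_dist:
  assumes "x \<in> {x. b \<le> infdist x F}" "y \<in> {y. infdist y F \<le> a}"
  shows "b - a \<le> dist x y"
  using assms infdist_triangle[of x F y] by (simp add: dist_commute)

text \<open>
  Caratheodory's criterion. The part of \<open>E\<close> at distance at least \<open>1/(n+1)\<close> from \<open>F\<close> is separated
  from \<open>E \<inter> F\<close>; the rest of \<open>E - F\<close> is covered by thin bands, and the bands of one parity are
  mutually separated, so that their outer measures are summable.
\<close>

lemma hausdorff1_outer_closed_split:
  fixes F E :: "'a::metric_space set"
  assumes F: "closed F"
  shows "hausdorff1_outer (E \<inter> F) + hausdorff1_outer (E - F) \<le> hausdorff1_outer E"
    (is "?H (E \<inter> F) + _ \<le> _")
proof (cases "F = {} \<or> ?H E = \<top>")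
  case True
  then show ?thesis by auto
next
  case False
  then have "F \<noteq> {}" and finE: "?H E < \<top>" by (auto simp: less_top)
  define u where "u x = infdist x F" for x
  define A where "A n = {x\<in>E. 1 / (real n + 1) \<le> u x}" for n
  define R where "R k = {x\<in>E. 1 / (real k + 2) \<le> u x \<and> u x < 1 / (real k + 1)}" for k
  have sep: "separated_sets X Y"
    if "X \<subseteq> {x. b \<le> u x}" "Y \<subseteq> {y. u y \<le> a}" "a < b" for X Y a b
    unfolding separated_sets_def
  proof (intro exI[of _ "b - a"] conjI ballI)
    fix x y assume "x \<in> X" "y \<in> Y"
    with that show "b - a \<le> dist x y"
      by (intro infdist_gap_le_dist[of _ _ F]) (auto simp: u_def)
  qed (use that in simp)
  have parity: "(\<Sum>k<n. ?H (R (2*k+j))) = ?H (\<Union>k<n. R (2*k+j))" for n j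
  proof (induction n)
    case (Suc n)
    have "separated_sets (\<Union>k<n. R (2*k+j)) (R (2*n+j))"
    \<comment> \<open>For \<open>n = 0\<close> the union is empty. Otherwise the skipped band of
      index 2n+j-1 lies between: \<open>u\<close> is at least 1/(2n+j) on the earlier bands and
      below 1/(2n+j+1) on the new one.\<close>
    proof (cases "n = 0")
      case True
      then show ?thesis by (auto simp: separated_sets_def intro: zero_less_one)
    next
      case False
      show ?thesis
      proof (rule sep)
        have "1 / (real (2*n+j)) \<le> u x" if "x \<in> R (2*k+j)" "k < n" for x k
        proof -
          have "1 / (real (2*n+j)) \<le> 1 / (real (2*k+j) + 2)"
            using that by (intro divide_left_mono) auto
          with that(1) show ?thesis by (auto simp: R_def)
        qed
        then show "(\<Union>k<n. R (2*k+j)) \<subseteq> {x. 1 / (real (2*n+j)) \<le> u x}" by auto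
        show "R (2*n+j) \<subseteq> {y. u y \<le> 1 / (real (2*n+j) + 1)}" by (auto simp: R_def)
        show "1 / (real (2*n+j) + 1) < 1 / (real (2*n+j))"
          using False by (intro divide_strict_left_mono) auto
      qed
    qed
    then have "?H ((\<Union>k<n. R (2*k+j)) \<union> R (2*n+j)) = ?H (\<Union>k<n. R (2*k+j)) + ?H (R (2*n+j))"
      by (rule hausdorff1_outer_Un_separated)
    moreover have "(\<Union>k<Suc n. R (2*k+j)) = (\<Union>k<n. R (2*k+j)) \<union> R (2*n+j)"
      by (auto simp: lessThan_Suc)
    ultimately show ?case using Suc by simp
  qed simp
  have parity_le: "(\<Sum>k<n. ?H (R (2*k+j))) \<le> ?H E" for n j
    unfolding parity by (intro hausdorff1_outer_mono) (auto simp: R_def)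
  have double: "(\<Sum>k<2*n. ?H (R k)) = (\<Sum>k<n. ?H (R (2*k+0))) + (\<Sum>k<n. ?H (R (2*k+1)))" for n
    by (induction n) (simp_all add: ac_simps)
  \<comment> \<open>Each parity class contributes at most \<open>?H E\<close>. The series therefore
    converges, and its tail bounds the outer measure of the bands nearest to
    \<open>F\<close>.\<close>
  have "(\<Sum>k. ?H (R k)) \<le> ?H E + ?H E"
  proof (rule suminf_le_const)
    fix n
    have "(\<Sum>k<n. ?H (R k)) \<le> (\<Sum>k<2*n. ?H (R k))"
      by (rule sum_mono2) auto
    also have "\<dots> \<le> ?H E + ?H E"
      unfolding double by (intro add_mono parity_le)
    finally show "(\<Sum>k<n. ?H (R k)) \<le> ?H E + ?H E" .
  qed auto
  then have sumfin: "(\<Sum>k. ?H (R k)) < \<top>"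
    using finE by (auto intro: le_less_trans)
  define r where "r k = enn2real (?H (R k))" for k
  have r: "?H (R k) = ennreal (r k)" for k
    using ennreal_suminf_lessD[OF sumfin, of k] by (simp add: r_def less_top)
  have r0: "0 \<le> r k" for k by (simp add: r_def)
  have summ: "summable r"
    using sumfin r0 by (intro summable_suminf_not_top) (auto simp: r)
  show ?thesis
  proof (rule ennreal_le_epsilon)
    fix e :: real assume "0 < e"
    obtain n where n: "norm (\<Sum>k. r (k + n)) < e"
      using suminf_exist_split[OF \<open>0 < e\<close> summ] by blast
    have sepA: "?H (E \<inter> F) + ?H (A n) \<le> ?H E"
    proof -
      have "separated_sets (A n) (E \<inter> F)"
        by (rule sep[of _ "1 / (real n + 1)" _ 0]) (auto simp: A_def u_def)
      then have "?H (A n \<union> (E \<inter> F)) = ?H (A n) + ?H (E \<inter> F)"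
        by (rule hausdorff1_outer_Un_separated)
      moreover have "?H (A n \<union> (E \<inter> F)) \<le> ?H E"
        by (intro hausdorff1_outer_mono) (auto simp: A_def)
      ultimately show ?thesis by (simp add: add.commute)
    qed
    have sub: "E - F \<subseteq> A n \<union> (\<Union>k. R (k + n))"
    proof
      fix x assume x: "x \<in> E - F"
      then have "u x > 0"
        using F \<open>F \<noteq> {}\<close> by (simp add: u_def infdist_pos_not_in_closed)
      show "x \<in> A n \<union> (\<Union>k. R (k + n))"
      proof (cases "1 / (real n + 1) \<le> u x")
        case True
        then show ?thesis using x by (simp add: A_def)
      next
        case False
        obtain N where N: "1 / u x < real N" using reals_Archimedean2 by blast
        have "1 / (real N + 2) \<le> u x"
          using N \<open>u x > 0\<close> by (simp add: field_simps)
        \<comment> \<open>The band containing \<open>x\<close>. Its upper edge follows from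
          minimality, since (k-1)+2 = k+1, except for \<open>k = n\<close>, where it follows from
          \<open>x\<close> not lying in \<open>A n\<close>.\<close>
        define k where "k = (LEAST k. 1 / (real k + 2) \<le> u x)"
        have k: "1 / (real k + 2) \<le> u x"
          unfolding k_def by (rule LeastI[of "\<lambda>k. 1 / (real k + 2) \<le> u x"]) fact
        have "n \<le> k"
        proof (rule ccontr)
          assume "\<not> n \<le> k"
          then have "1 / (real n + 1) \<le> 1 / (real k + 2)" by (intro divide_left_mono) auto
          with k False show False by simp
        qed
        have "u x < 1 / (real k + 1)"
        proof (cases "k = n")
          case True
          then show ?thesis using False by simp
        next
          case neq: False
          then have "\<not> 1 / (real (k - 1) + 2) \<le> u x"
            using \<open>n \<le> k\<close> by (intro not_less_Least[of _ "\<lambda>k. 1 / (real k + 2) \<le> u x", folded k_def]) auto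
          then show ?thesis using neq \<open>n \<le> k\<close> by (simp add: of_nat_diff not_le algebra_simps)
        qed
        with k x have "x \<in> R ((k - n) + n)"
          using \<open>n \<le> k\<close> by (simp add: R_def)
        then show ?thesis by blast
      qed
    qed
    have "?H (E - F) \<le> ?H (A n \<union> (\<Union>k. R (k + n)))"
      by (rule hausdorff1_outer_mono[OF sub])
    also have "\<dots> \<le> ?H (A n) + ?H (\<Union>k. R (k + n))"
      by (rule hausdorff1_outer_Un_le)
    also have "\<dots> \<le> ?H (A n) + (\<Sum>k. ?H (R (k + n)))"
      by (intro add_left_mono hausdorff1_outer_countably_subadditive)
    also have "(\<Sum>k. ?H (R (k + n))) = ennreal (\<Sum>k. r (k + n))"
      unfolding r using r0 summ by (intro suminf_ennreal2) (auto simp: summable_iff_shift)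
    also have "\<dots> \<le> ennreal e"
      using n by (intro ennreal_leI) simp
    finally have "?H (E \<inter> F) + ?H (E - F) \<le> ?H (E \<inter> F) + (?H (A n) + ennreal e)"
      by (auto intro: add_left_mono)
    also have "\<dots> \<le> ?H E + ennreal e"
      using sepA by (simp add: add.assoc[symmetric] add_right_mono)
    finally show "?H (E \<inter> F) + ?H (E - F) \<le> ?H E + ennreal e" .
  qed
qed

text \<open>The lambda system of the outer measure, taken inside all subsets, is a sigma-algebra on
  which it is a measure. The splitting lemma puts the closed sets into it, and these generate the
  Borel sets.\<close>

lemma measure_space_hausdorff1:
  "measure_space UNIV (sets borel) (hausdorff1_outer :: 'a::metric_space set \<Rightarrow> ennreal)"
proof -
  let ?H = "hausdorff1_outer :: 'a set \<Rightarrow> ennreal"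
  interpret P: sigma_algebra UNIV "UNIV :: 'a set set"
    using sigma_algebra_Pow[of "UNIV :: 'a set"] by simp
  define L where "L = lambda_system UNIV UNIV ?H"
  have L: "measure_space UNIV L ?H"
    unfolding L_def by (rule P.caratheodory_lemma[OF outer_measure_space_hausdorff1])
  interpret L: sigma_algebra UNIV L
    using L by (simp add: measure_space_def)
  have "Collect closed \<subseteq> L"
  proof
    fix F :: "'a set" assume "F \<in> Collect closed"
    then have "?H (E \<inter> F) + ?H (E - F) = ?H E" for E
      using hausdorff1_outer_closed_split[of F E] hausdorff1_outer_Un_le[of "E \<inter> F" "E - F"]
      by (simp add: Int_Diff_Un)
    then show "F \<in> L" by (simp add: L_def P.lambda_system_eq)
  qed
  then have "sets borel \<subseteq> L"
    unfolding borel_eq_closed by (simp add: L.sigma_sets_subset)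
  then show ?thesis
    using measure_down[OF L sets.sigma_algebra_axioms[of borel, simplified]] by simp
qed

lemma sets_hausdorff1 [simp, measurable_cong]: "sets hausdorff1 = sets borel"
  using sets.sigma_sets_eq[of borel] by (simp add: hausdorff1_def)

lemma space_hausdorff1 [simp]: "space hausdorff1 = UNIV"
  by (simp add: hausdorff1_def)

lemma emeasure_hausdorff1:
  assumes "A \<in> sets borel"
  shows "emeasure hausdorff1 A = hausdorff1_outer A"
  unfolding hausdorff1_def
  using measure_space_hausdorff1 assms sets.sigma_sets_eq[of borel]
  by (intro emeasure_measure_of_sigma) (auto simp: measure_space_def)

section \<open>Hausdorff measure against Lebesgue measure along a segment\<close>

lemma subset_interval_of_dist_le:
  fixes S :: "real set"
  assumes "\<And>s r. s \<in> S \<Longrightarrow> r \<in> S \<Longrightarrow> \<bar>s - r\<bar> \<le> d"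
  shows "\<exists>a. S \<subseteq> {a..a + d}"
proof (cases "S = {}")
  case False
  then obtain s0 where s0: "s0 \<in> S" by blast
  have bdd: "bdd_below S"
    using assms[OF s0] by (intro bdd_belowI[of _ "s0 - d"]) (force simp: abs_le_iff)
  have "s \<in> {Inf S..Inf S + d}" if "s \<in> S" for s
  proof -
    have "s - d \<le> Inf S"
      using assms[OF that] by (intro cInf_greatest False) (force simp: abs_le_iff)
    then show ?thesis using cInf_lower[OF that bdd] by simp
  qed
  then show ?thesis by blast
qed simp

text \<open>A cover of the image pulls back to a cover of \<open>E\<close> by intervals of length
  diameter/c. This works for covers of any mesh, and the premeasure at every positive scale, here 1,
  lies below the outer measure.\<close>

lemma hausdorff1_outer_similarity_ge:
  fixes \<phi> :: "real \<Rightarrow> 'a::metric_space"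
  assumes E: "E \<in> sets borel" and c: "c > 0"
    and \<phi>: "\<And>s r. s \<in> E \<Longrightarrow> r \<in> E \<Longrightarrow> dist (\<phi> s) (\<phi> r) = c * \<bar>s - r\<bar>"
  shows "ennreal c * emeasure lborel E \<le> hausdorff1_outer (\<phi> ` E)"
proof -
  have "ennreal c * emeasure lborel E \<le> hausdorff1_pre 1 (\<phi> ` E)"
  proof (rule hausdorff1_pre_greatest)
    fix U :: "nat \<Rightarrow> 'a set"
    assume U: "\<phi> ` E \<subseteq> (\<Union>i. U i)" "\<And>i. bounded (U i)"
    have "\<exists>a. {s\<in>E. \<phi> s \<in> U i} \<subseteq> {a..a + diameter (U i) / c}" for i
    proof (rule subset_interval_of_dist_le)
      fix s r assume "s \<in> {s\<in>E. \<phi> s \<in> U i}" "r \<in> {s\<in>E. \<phi> s \<in> U i}"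
      then have "c * \<bar>s - r\<bar> \<le> diameter (U i)"
        using diameter_bounded_bound[OF U(2)[of i], of "\<phi> s" "\<phi> r"] \<phi>[of s r] by simp
      then show "\<bar>s - r\<bar> \<le> diameter (U i) / c" using c by (simp add: field_simps)
    qed
    then obtain a where a: "\<And>i. {s\<in>E. \<phi> s \<in> U i} \<subseteq> {a i..a i + diameter (U i) / c}" by metis
    have "E \<subseteq> (\<Union>i. {a i..a i + diameter (U i) / c})"
      using U(1) a by blast
    then have "emeasure lborel E \<le> emeasure lborel (\<Union>i. {a i..a i + diameter (U i) / c})"
      by (intro emeasure_mono) auto
    also have "\<dots> \<le> (\<Sum>i. emeasure lborel {a i..a i + diameter (U i) / c})"
      by (intro emeasure_subadditive_countably) auto
    also have "\<dots> = (\<Sum>i. ennreal (diameter (U i) / c))"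
      using c diameter_ge_0[OF U(2)] by (intro suminf_cong) (simp add: emeasure_lborel_Icc)
    finally have "ennreal c * emeasure lborel E \<le> ennreal c * (\<Sum>i. ennreal (diameter (U i) / c))"
      by (rule mult_left_mono) simp
    also have "\<dots> = (\<Sum>i. ennreal c * ennreal (diameter (U i) / c))"
      by (rule ennreal_suminf_cmult[symmetric])
    also have "\<dots> = (\<Sum>i. ennreal (diameter (U i)))"
      using c diameter_ge_0[OF U(2)] by (simp add: ennreal_mult[symmetric])
    finally show "ennreal c * emeasure lborel E \<le> (\<Sum>i. ennreal (diameter (U i)))" .
  qed
  also have "\<dots> \<le> hausdorff1_outer (\<phi> ` E)" by (rule hausdorff1_pre_le_outer) simp
  finally show ?thesis .
qed

lemma hausdorff1_outer_lipschitz_le: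
  fixes \<phi> :: "real \<Rightarrow> 'a::metric_space"
  assumes c: "c \<ge> 0"
    and \<phi>: "\<And>s r. s \<in> {0..1} \<Longrightarrow> r \<in> {0..1} \<Longrightarrow> dist (\<phi> s) (\<phi> r) \<le> c * \<bar>s - r\<bar>"
  shows "hausdorff1_outer (\<phi> ` {0..1}) \<le> ennreal c"
  unfolding hausdorff1_outer_def
proof (rule SUP_least)
  fix \<delta> :: real assume "\<delta> \<in> {0<..}"
  then have \<delta>: "\<delta> > 0" by simp
  obtain n0 where n0: "c / \<delta> < real n0" using reals_Archimedean2 by blast
  define n where "n = Suc n0"
  have n: "n > 0" "c / real n \<le> \<delta>"
    using n0 \<delta> by (auto simp: n_def field_simps)
  define J where "J i = {real i / real n..real (Suc i) / real n}" for i
  define U where "U i = (if i < n then \<phi> ` J i else {})" for i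
  have J: "J i \<subseteq> {0..1}" if "i < n" for i
    using that n by (auto simp: J_def field_simps)
  have dst: "dist x y \<le> c / real n" if "x \<in> U i" "y \<in> U i" "i < n" for x y i
  proof -
    from that obtain s r where sr: "s \<in> J i" "r \<in> J i" "x = \<phi> s" "y = \<phi> r"
      by (auto simp: U_def)
    have "dist x y \<le> c * \<bar>s - r\<bar>"
      using sr J[OF that(3)] by (auto intro: \<phi>)
    also have "\<bar>s - r\<bar> \<le> 1 / real n"
      using sr n by (auto simp: J_def abs_le_iff field_simps)
    finally show ?thesis using c by (simp add: mult_left_mono)
  qed
  have dm: "diameter (U i) \<le> c / real n" if "i < n" for i
    unfolding diameter_def using dst[OF _ _ that] n c by (auto intro!: cSUP_least)
  have "hausdorff1_pre \<delta> (\<phi> ` {0..1}) \<le> (\<Sum>i. ennreal (diameter (U i)))"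
  proof (rule hausdorff1_pre_le)
    show "\<phi> ` {0..1} \<subseteq> (\<Union>i. U i)"
    proof clarify
      fix s :: real assume s: "s \<in> {0..1}"
      \<comment> \<open>The minimum with \<open>n0\<close> takes care of \<open>s = 1\<close>, whose
        floor index \<open>n\<close> would be one too large.\<close>
      define i where "i = min n0 (nat \<lfloor>real n * s\<rfloor>)"
      have "s \<in> J i"
      proof (cases "s = 1")
        case True
        then show ?thesis by (auto simp: J_def i_def n_def min_def nat_le_real_less)
      next
        case False
        then have "real n * s < real n" using s n by simp
        then have "\<lfloor>real n * s\<rfloor> < int (Suc n0)" by (simp add: floor_less_iff n_def)
        then have *: "i = nat \<lfloor>real n * s\<rfloor>" by (simp add: i_def)
        have "real i \<le> real n * s" "real n * s \<le> real (Suc i)"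
          unfolding * using s n by (auto simp: of_nat_nat) linarith
        then show ?thesis using n by (simp add: J_def field_simps)
      qed
      moreover have "i < n" by (simp add: i_def n_def)
      ultimately show "\<phi> s \<in> (\<Union>i. U i)" by (auto simp: U_def)
    qed
    show "bounded (U i)" for i
      using dst[of _ i] by (cases "i < n") (auto simp: U_def bounded_two_points)
    show "diameter (U i) \<le> \<delta>" for i
      using dm[of i] n \<delta> by (cases "i < n") (auto simp: U_def)
  qed
  also have "\<dots> = (\<Sum>i<n. ennreal (diameter (U i)))"
    by (rule suminf_finite) (auto simp: U_def)
  also have "\<dots> \<le> (\<Sum>i<n. ennreal (c / real n))"
    by (intro sum_mono ennreal_leI dm) auto
  also have "\<dots> = ennreal c"
    using n c by (simp add: ennreal_of_nat_eq_real_of_nat ennreal_mult[symmetric])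
  finally show "hausdorff1_pre \<delta> (\<phi> ` {0..1}) \<le> ennreal c" .
qed

text \<open>A squeeze: the lower bound is available for \<open>E\<close> and for its complement in
  [0,1], the upper bound only for the whole segment. Since the two lower bounds add up to
  \<open>norm d\<close>, neither can be strict, so arbitrary Borel pieces need no upper estimate of
  their own. The case \<open>d = 0\<close> is included and shows that points are null.\<close>

lemma emeasure_hausdorff1_segment:
  fixes v d :: "'a::euclidean_space"
  assumes B: "B \<in> sets borel"
  shows "emeasure hausdorff1 (B \<inter> closed_segment v (v + d)) =
    ennreal (norm d) * emeasure lborel {s\<in>{0..1}. v + s *\<^sub>R d \<in> B}"
proof -
  define \<phi> where "\<phi> s = v + s *\<^sub>R d" for s :: real
  define E where "E = {s\<in>{0..1}. v + s *\<^sub>R d \<in> B}"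
  let ?S = "closed_segment v (v + d)"
  have \<phi>_cont: "continuous_on UNIV \<phi>" unfolding \<phi>_def by (intro continuous_intros)
  have E: "E \<in> sets borel"
  proof -
    have "\<phi> -` B \<inter> space borel \<in> sets borel"
      using B \<phi>_cont by (intro measurable_sets[OF borel_measurable_continuous_onI]) auto
    moreover have "E = {0..1} \<inter> (\<phi> -` B)" by (auto simp: E_def \<phi>_def)
    ultimately show ?thesis by auto
  qed
  have seg: "?S = \<phi> ` {0..1}"
    by (auto simp: closed_segment_def \<phi>_def image_iff algebra_simps)
  have im: "\<phi> ` E \<subseteq> B \<inter> ?S" "\<phi> ` ({0..1} - E) \<subseteq> ?S - B"
    by (auto simp: seg E_def \<phi>_def)
  have dst: "dist (\<phi> s) (\<phi> r) = norm d * \<bar>s - r\<bar>" for s r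
    by (simp add: \<phi>_def dist_norm flip: scaleR_left_diff_distrib)
  have S: "?S \<in> sets borel" by (intro borel_closed) auto
  have low: "ennreal (norm d) * emeasure lborel X \<le> hausdorff1_outer (\<phi> ` X)"
    if "X \<in> sets borel" for X
  proof (cases "d = 0")
    case False
    then show ?thesis using that dst by (intro hausdorff1_outer_similarity_ge) auto
  qed simp
  have up: "hausdorff1_outer ?S \<le> ennreal (norm d)"
    unfolding seg by (rule hausdorff1_outer_lipschitz_le) (auto simp: dst)
  have 1: "ennreal (norm d) * emeasure lborel E \<le> emeasure hausdorff1 (B \<inter> ?S)"
    using low[OF E] hausdorff1_outer_mono[OF im(1)] B S by (simp add: emeasure_hausdorff1)
  have 2: "ennreal (norm d) * emeasure lborel ({0..1} - E) \<le> emeasure hausdorff1 (?S - B)"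
    using low[of "{0..1} - E"] E hausdorff1_outer_mono[OF im(2)] B S
    by (simp add: emeasure_hausdorff1)
  have 3: "emeasure hausdorff1 (B \<inter> ?S) + emeasure hausdorff1 (?S - B) \<le> ennreal (norm d)"
  proof -
    have "B \<inter> ?S \<union> (?S - B) = ?S" "(B \<inter> ?S) \<inter> (?S - B) = {}" by auto
    then show ?thesis
      using up B S plus_emeasure[of "B \<inter> ?S" hausdorff1 "?S - B"] by (simp add: emeasure_hausdorff1)
  qed
  have 4: "ennreal (norm d) * emeasure lborel E + ennreal (norm d) * emeasure lborel ({0..1} - E) = ennreal (norm d)"
  proof -
    have "emeasure lborel E + emeasure lborel ({0..1} - E) = emeasure lborel {0..1::real}"
    proof -
      have "E \<union> ({0..1} - E) = {0..1}" "E \<inter> ({0..1} - E) = {}" by (auto simp: E_def)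
      then show ?thesis using E plus_emeasure[of E lborel "{0..1} - E"] by simp
    qed
    then show ?thesis by (simp flip: distrib_left)
  qed
  have "emeasure hausdorff1 (B \<inter> ?S) \<le> ennreal (norm d) * emeasure lborel E"
  proof -
    have "emeasure hausdorff1 (B \<inter> ?S) + ennreal (norm d) * emeasure lborel ({0..1} - E)
      \<le> ennreal (norm d) * emeasure lborel E + ennreal (norm d) * emeasure lborel ({0..1} - E)"
      unfolding 4 using 2 3 by (meson add_left_mono order_trans)
    moreover have "ennreal (norm d) * emeasure lborel ({0..1} - E) \<noteq> \<top>"
      using 4 by (metis ennreal_add_eq_top ennreal_neq_top)
    ultimately show ?thesis
      by (simp add: ennreal_add_left_cancel_le add.commute)
  qed
  with 1 show ?thesis unfolding E_def by (rule antisym[rotated])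
qed

section \<open>The uniform measure on a V\<close>

definition unif :: "real measure" where
  "unif = uniform_measure lborel {-1..1}"

lemma sets_unif [simp, measurable_cong]: "sets unif = sets borel"
  by (simp add: unif_def)

lemma space_unif [simp]: "space unif = UNIV"
  by (simp add: unif_def)

lemma prob_space_unif: "prob_space unif"
  unfolding unif_def by (rule prob_space_uniform_measure) auto

lemma emeasure_unif: "A \<in> sets borel \<Longrightarrow> emeasure unif A = emeasure lborel ({-1..1} \<inter> A) / 2"
  by (simp add: unif_def)

lemma nn_integral_unif:
  assumes [measurable]: "h \<in> borel_measurable borel"
  shows "(\<integral>\<^sup>+u. h u \<partial>unif) = (\<integral>\<^sup>+u. h u * indicator {-1..1} u \<partial>lborel) / 2"
  unfolding unif_def by (subst nn_integral_uniform_measure) auto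

lemma ennreal_two_times_half: "2 * (z / 2) = (z :: ennreal)"
  by (simp add: ennreal_times_divide mult.commute[of 2] mult_divide_eq_ennreal)

text \<open>Brings both halves to [0,1], the parameter range of a single segment. The point 0 occurs
  in both terms, but it is a null set.\<close>

lemma emeasure_unif_symmetric_halves:
  assumes [measurable]: "A \<in> sets borel"
  shows "emeasure unif A =
    (emeasure lborel ({0..1} \<inter> A) + emeasure lborel ({0..1} \<inter> uminus -` A)) / 2"
proof -
  have [measurable]: "uminus -` A \<in> sets borel"
    using measurable_sets[of uminus borel borel A] by simp
  have "emeasure lborel ({-1..1} \<inter> A) = emeasure lborel ({0..1} \<inter> A \<union> {-1..<0} \<inter> A)"
    by (rule arg_cong[where f = "emeasure lborel"]) auto
  also have "\<dots> = emeasure lborel ({0..1} \<inter> A) + emeasure lborel ({-1..<0} \<inter> A)"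
    by (rule plus_emeasure[symmetric]) auto
  also have "emeasure lborel ({-1..<0} \<inter> A) = emeasure (distr lborel borel uminus) ({-1..<0} \<inter> A)"
    by (simp add: lborel_distr_uminus)
  also have "\<dots> = emeasure lborel (uminus -` ({-1..<0} \<inter> A))"
    by (subst emeasure_distr) auto
  also have "\<dots> = emeasure lborel ({0..1} \<inter> uminus -` A)"
  proof -
    have "AE x in lborel. x \<noteq> (0::real)" by (rule AE_lborel_singleton)
    then show ?thesis by (intro emeasure_eq_AE) auto
  qed
  finally show ?thesis by (simp add: emeasure_unif)
qed

text \<open>A V with vertex \<open>v\<close>, whose arm along \<open>d\<close> is run through for
  positive and whose arm along \<open>d'\<close> for negative parameters. Writing it with
  \<open>max\<close> instead of a case distinction yields the Lipschitz bound without splitting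
  cases at the vertex.\<close>

definition vee :: "'a::euclidean_space \<Rightarrow> 'a \<Rightarrow> 'a \<Rightarrow> real \<Rightarrow> 'a" where
  "vee v d d' u = v + max 0 u *\<^sub>R d + max 0 (- u) *\<^sub>R d'"

lemma lipschitz_on_vee: "(norm d + norm d')-lipschitz_on X (vee v d d')"
proof (rule lipschitz_onI)
  fix u w :: real
  have "vee v d d' u - vee v d d' w = (max 0 u - max 0 w) *\<^sub>R d + (max 0 (- u) - max 0 (- w)) *\<^sub>R d'"
    by (simp add: vee_def algebra_simps)
  also have "norm \<dots> \<le> \<bar>max 0 u - max 0 w\<bar> * norm d + \<bar>max 0 (- u) - max 0 (- w)\<bar> * norm d'"
    by (rule norm_triangle_le) simp
  also have "\<dots> \<le> \<bar>u - w\<bar> * norm d + \<bar>u - w\<bar> * norm d'"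
    by (intro add_mono mult_right_mono) auto
  finally show "dist (vee v d d' u) (vee v d d' w) \<le> (norm d + norm d') * dist u w"
    by (simp add: dist_norm algebra_simps)
qed simp

lemma continuous_on_vee: "continuous_on X (vee v d d')"
  by (rule lipschitz_on_continuous_on[OF lipschitz_on_vee])

lemma measurable_vee [measurable]: "vee v d d' \<in> borel_measurable borel"
  by (intro borel_measurable_continuous_onI continuous_on_vee)

lemma vee_eq_if: "vee v d d' u = v + \<bar>u\<bar> *\<^sub>R (if 0 \<le> u then d else d')"
  by (simp add: vee_def)

text \<open>Arms of equal length are traversed with equal constant speed, so the parameter
  distributes mass in proportion to length. The arms share only the vertex, which is a degenerate
  segment and hence null.\<close>

lemma arclength_measure_two_segments:
  fixes v d d' :: "'a::euclidean_space"
  assumes norm: "norm d = norm d'" "d \<noteq> 0"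
    and int: "closed_segment v (v + d) \<inter> closed_segment v (v + d') = {v}"
  shows "arclength_measure (closed_segment v (v + d) \<union> closed_segment v (v + d')) = distr unif borel (vee v d d')"
proof -
  define \<gamma> where "\<gamma> = vee v d d'"
  have \<gamma>: "\<gamma> u = v + \<bar>u\<bar> *\<^sub>R (if 0 \<le> u then d else d')" for u
    by (simp add: \<gamma>_def vee_eq_if)
  let ?S = "closed_segment v (v + d)" and ?S' = "closed_segment v (v + d')"
  have S[measurable]: "?S \<in> sets borel" "?S' \<in> sets borel" by (auto intro: borel_closed)
  have [measurable]: "\<gamma> \<in> borel_measurable borel" by (simp add: \<gamma>_def)
  have "emeasure hausdorff1 ({v} \<inter> closed_segment v (v + 0)) = 0"
    by (subst emeasure_hausdorff1_segment) auto
  then have null: "{v} \<in> null_sets hausdorff1" by (simp add: null_sets_def)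
  have main: "emeasure hausdorff1 ((?S \<union> ?S') \<inter> B) = ennreal (2 * norm d) * emeasure unif (\<gamma> -` B)"
    if [measurable]: "B \<in> sets borel" for B
  proof -
    have [measurable]: "\<gamma> -` B \<in> sets borel"
      using measurable_sets[of \<gamma> borel borel B] by simp
    have "emeasure hausdorff1 ((?S \<union> ?S') \<inter> B) = emeasure hausdorff1 (B \<inter> ?S \<union> (B \<inter> ?S' - {v}))"
      using int by (intro arg_cong[where f = "emeasure hausdorff1"]) auto
    also have "\<dots> = emeasure hausdorff1 (B \<inter> ?S) + emeasure hausdorff1 (B \<inter> ?S' - {v})"
      using int by (intro plus_emeasure[symmetric]) auto
    also have "emeasure hausdorff1 (B \<inter> ?S' - {v}) = emeasure hausdorff1 (B \<inter> ?S')"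
      by (intro emeasure_Diff_null_set null) auto
    also have "emeasure hausdorff1 (B \<inter> ?S) + emeasure hausdorff1 (B \<inter> ?S')
      = ennreal (norm d) * (emeasure lborel {s\<in>{0..1}. v + s *\<^sub>R d \<in> B} + emeasure lborel {s\<in>{0..1}. v + s *\<^sub>R d' \<in> B})"
      using norm by (simp add: emeasure_hausdorff1_segment distrib_left)
    also have "{s\<in>{0..1}. v + s *\<^sub>R d \<in> B} = {0..1} \<inter> \<gamma> -` B"
      by (auto simp: \<gamma>)
    also have "emeasure lborel {s\<in>{0..1}. v + s *\<^sub>R d' \<in> B} = emeasure lborel ({0..1} \<inter> uminus -` (\<gamma> -` B))"
    proof (rule emeasure_eq_AE)
      have "AE x in lborel. x \<noteq> (0::real)" by (rule AE_lborel_singleton)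
      then show "AE x in lborel. (x \<in> {s\<in>{0..1}. v + s *\<^sub>R d' \<in> B}) = (x \<in> {0..1} \<inter> uminus -` (\<gamma> -` B))"
        by eventually_elim (auto simp: \<gamma>)
    qed measurable
    also have "emeasure lborel ({0..1} \<inter> \<gamma> -` B) + emeasure lborel ({0..1} \<inter> uminus -` (\<gamma> -` B))
      = 2 * emeasure unif (\<gamma> -` B)"
      by (subst emeasure_unif_symmetric_halves) (simp_all only: ennreal_two_times_half, measurable)
    finally show ?thesis by (simp add: ennreal_mult' ac_simps)
  qed
  have total: "emeasure hausdorff1 (?S \<union> ?S') = ennreal (2 * norm d)"
    using main[of UNIV] prob_space.emeasure_space_1[OF prob_space_unif] by simp
  show ?thesis
  proof (rule measure_eqI)
    fix B assume "B \<in> sets (arclength_measure (?S \<union> ?S'))"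
    then have B[measurable]: "B \<in> sets borel" by (simp add: arclength_measure_def)
    have "emeasure (arclength_measure (?S \<union> ?S')) B = ennreal (2 * norm d) * emeasure unif (\<gamma> -` B) / ennreal (2 * norm d)"
      unfolding arclength_measure_def by (subst emeasure_uniform_measure) (auto simp: main total)
    also have "\<dots> = emeasure unif (\<gamma> -` B)"
      using norm by (subst mult.commute, subst mult_divide_eq_ennreal) auto
    finally show "emeasure (arclength_measure (?S \<union> ?S')) B = emeasure (distr unif borel (vee v d d')) B"
      by (simp add: emeasure_distr flip: \<gamma>_def)
  qed (simp add: arclength_measure_def)
qed

section \<open>The Talagrand inequality\<close>

lemma sq_diff_one_le_entropy:
  fixes x :: real
  assumes "x \<ge> 0"
  shows "(x - 1)\<^sup>2 \<le> 2 * (1 + x) * (x * ln x - x + 1)"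
proof (cases "x = 0")
  case False
  \<comment> \<open>Factor (x-1)^2 = (s+1)^2 (s-1)^2. The second factor is at most x ln x - x + 1,
    by \<open>ln (1 / s) \<le> 1 / s - 1\<close>, and the first is at most 2(1+x).\<close>
  define s where "s = sqrt x"
  have s: "s > 0" "x = s\<^sup>2" using assms False by (auto simp: s_def)
  have "ln (1 / s) \<le> 1 / s - 1" using s by (intro ln_le_minus_one) auto
  then have "1 - 1 / s \<le> ln s" using s by (simp add: ln_div)
  then have "2 * x * (1 - 1 / s) \<le> 2 * x * ln s" using assms by (intro mult_left_mono) auto
  moreover have "x * ln x = 2 * x * ln s" using s by (simp add: ln_realpow)
  moreover have "2 * x * (1 - 1 / s) = 2 * x - 2 * s" using s by (simp add: field_simps power2_eq_square)
  ultimately have "(s - 1)\<^sup>2 \<le> x * ln x - x + 1" using s by (simp add: power2_eq_square algebra_simps)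
  moreover have "(s + 1)\<^sup>2 \<le> 2 * (1 + x)"
    using s zero_le_power2[of "s - 1"] by (simp add: power2_eq_square algebra_simps)
  ultimately have "(s + 1)\<^sup>2 * (s - 1)\<^sup>2 \<le> 2 * (1 + x) * (x * ln x - x + 1)"
    using assms by (intro mult_mono) auto
  moreover have "(x - 1)\<^sup>2 = (s + 1)\<^sup>2 * (s - 1)\<^sup>2"
    using s by (simp add: power2_eq_square algebra_simps)
  ultimately show ?thesis by simp
qed simp

lemma four_mult_le_square_add: "4 * a * b \<le> (a + b)\<^sup>2" for a b :: real
  using zero_le_power2[of "a - b"] by (simp add: power2_eq_square algebra_simps)

text \<open>Cauchy-Schwarz in the form of a weighted arithmetic-geometric mean: the pointwise bound
  is split with a free weight \<open>\<epsilon>\<close> and integrated. The resulting constant 4 is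
  twice the sharp one.\<close>

lemma (in prob_space) pinsker:
  fixes f :: "'a \<Rightarrow> real"
  assumes f: "integrable M f" "\<And>x. 0 \<le> f x" "(\<integral>x. f x \<partial>M) = 1"
    and flnf: "integrable M (\<lambda>x. f x * ln (f x))"
  shows "(\<integral>x. \<bar>f x - 1\<bar> \<partial>M)\<^sup>2 \<le> 4 * (\<integral>x. f x * ln (f x) \<partial>M)"
proof -
  define A where "A = (\<integral>x. \<bar>f x - 1\<bar> \<partial>M)"
  define H where "H = (\<integral>x. f x * ln (f x) \<partial>M)"
  have \<phi>: "0 \<le> f x * ln (f x) - f x + 1" for x
    using sq_diff_one_le_entropy[OF f(2)[of x]] f(2)[of x]
    by (smt (verit, best) mult_pos_neg zero_le_power2)
  have bound: "A \<le> \<epsilon> + H / \<epsilon>" if "\<epsilon> > 0" for \<epsilon>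
  proof -
    have "\<bar>f x - 1\<bar> \<le> \<epsilon> * (1 + f x) / 2 + (f x * ln (f x) - f x + 1) / \<epsilon>" for x
    proof -
      let ?a = "\<epsilon> * (1 + f x) / 2" and ?b = "(f x * ln (f x) - f x + 1) / \<epsilon>"
      have "4 * ?a * ?b = 2 * (1 + f x) * (f x * ln (f x) - f x + 1)"
        using that by (simp add: field_simps)
      then have "\<bar>f x - 1\<bar>\<^sup>2 \<le> 4 * ?a * ?b"
        using sq_diff_one_le_entropy[OF f(2)[of x]] by simp
      also have "\<dots> \<le> (?a + ?b)\<^sup>2"
        by (rule four_mult_le_square_add)
      finally show ?thesis
      proof (rule power2_le_imp_le)
        show "0 \<le> ?a + ?b"
          using f(2)[of x] that by (intro add_nonneg_nonneg divide_nonneg_pos[OF \<phi> that]) simp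
      qed
    qed
    then have "A \<le> (\<integral>x. \<epsilon> * (1 + f x) / 2 + (f x * ln (f x) - f x + 1) / \<epsilon> \<partial>M)"
      unfolding A_def using f flnf by (intro integral_mono) auto
    also have "\<dots> = \<epsilon> + H / \<epsilon>"
      using f flnf by (simp add: H_def prob_space)
    finally show ?thesis .
  qed
  show ?thesis
  proof (cases "A > 0")
    case True
    \<comment> \<open>With the weight A/2 one half of A is absorbed on the left, which gives the
      same constant as the best weight \<open>sqrt H\<close>.\<close>
    then have "A \<le> A / 2 + H / (A / 2)" by (intro bound) auto
    then have "A\<^sup>2 \<le> 4 * H" using True by (simp add: field_simps power2_eq_square)
    then show ?thesis by (simp add: A_def H_def)
  next
    case False
    then have "A = 0" unfolding A_def by (intro antisym) (auto simp: not_less)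
    have "0 \<le> H"
    proof -
      have "0 \<le> (\<integral>x. f x * ln (f x) - f x + 1 \<partial>M)"
        by (intro integral_nonneg_AE AE_I2 \<phi>)
      also have "\<dots> = H" using f(1,3) flnf by (simp add: H_def prob_space)
      finally show ?thesis .
    qed
    with \<open>A = 0\<close> show ?thesis by (simp add: A_def H_def)
  qed
qed

section \<open>Quantile coupling with the uniform measure\<close>

lemma distr_unit_interval_eq_unif:
  "distr (restrict_space lborel {0<..<1}) borel (\<lambda>\<omega>. 2 * \<omega> - 1) = unif"
proof (rule measure_eqI)
  fix A :: "real set" assume "A \<in> sets (distr (restrict_space lborel {0<..<1}) borel (\<lambda>\<omega>. 2 * \<omega> - 1))"
  then have [measurable]: "A \<in> sets borel" by simp
  have [measurable]: "(\<lambda>\<omega>::real. 2 * \<omega> - 1) \<in> restrict_space lborel {0<..<1} \<rightarrow>\<^sub>M borel"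
    by (intro measurable_restrict_space1) auto
  have pre: "(\<lambda>\<omega>. 2 * \<omega> - 1) -` A \<inter> {0<..<1} = {\<omega>\<in>{0<..<1}. 2 * \<omega> - 1 \<in> A}" by auto
  have "emeasure unif A = (\<integral>\<^sup>+u. indicator ({-1..1} \<inter> A) u \<partial>lborel) / 2"
    by (simp add: emeasure_unif)
  also have "(\<integral>\<^sup>+u. indicator ({-1..1} \<inter> A) u \<partial>lborel) = 2 * (\<integral>\<^sup>+\<omega>. indicator ({-1..1} \<inter> A) (-1 + 2 * \<omega>) \<partial>lborel)"
    by (subst nn_integral_real_affine[of _ 2 "-1"]) auto
  also have "2 * (\<integral>\<^sup>+\<omega>. indicator ({-1..1} \<inter> A) (-1 + 2 * \<omega>) \<partial>lborel) / 2
      = (\<integral>\<^sup>+\<omega>. indicator ({-1..1} \<inter> A) (-1 + 2 * \<omega>) \<partial>lborel)"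
    by (simp add: mult.commute[of 2] mult_divide_eq_ennreal)
  also have "\<dots> = (\<integral>\<^sup>+\<omega>. indicator {\<omega>\<in>{0<..<1}. 2 * \<omega> - 1 \<in> A} \<omega> \<partial>lborel)"
    using AE_lborel_singleton[of 0] AE_lborel_singleton[of 1]
    by (intro nn_integral_cong_AE, eventually_elim) (auto simp: indicator_def)
  also have "\<dots> = emeasure lborel {\<omega>\<in>{0<..<1}. 2 * \<omega> - 1 \<in> A}"
    by (intro nn_integral_indicator) measurable
  also have "\<dots> = emeasure (distr (restrict_space lborel {0<..<1}) borel (\<lambda>\<omega>. 2 * \<omega> - 1)) A"
    by (subst emeasure_distr)
      (auto simp: space_restrict_space pre intro!: emeasure_restrict_space[symmetric])
  finally show "emeasure (distr (restrict_space lborel {0<..<1}) borel (\<lambda>\<omega>. 2 * \<omega> - 1)) A = emeasure unif A" ..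
qed simp

text \<open>At x = I \<omega> the distribution function of the tilted measure is \<omega> and that
  of \<open>unif\<close> is (1+x)/2. So 2\<omega> - 1 - x is twice the difference of the two
  distribution functions at x, and that difference is the integral of h - 1 over a
  half-line.\<close>

lemma quantile_displacement_le:
  fixes h :: "real \<Rightarrow> real"
  assumes h: "integrable unif h" "\<And>u. 0 \<le> h u" "(\<integral>u. h u \<partial>unif) = 1"
  obtains I where "I \<in> borel_measurable (restrict_space borel {0<..<1})"
    "distr (restrict_space lborel {0<..<1}) borel I = density unif h"
    "\<And>\<omega>. \<omega> \<in> {0<..<1} \<Longrightarrow> I \<omega> \<in> {-1..1}"
    "\<And>\<omega>. \<omega> \<in> {0<..<1} \<Longrightarrow> \<bar>2 * \<omega> - 1 - I \<omega>\<bar> \<le> 2 * (\<integral>u. \<bar>h u - 1\<bar> \<partial>unif)"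
proof -
  interpret U: prob_space unif by (rule prob_space_unif)
  have [measurable]: "h \<in> borel_measurable borel" using h(1) by auto
  let ?N = "density unif h"
  have int_h: "integrable unif (\<lambda>u. indicator B u * h u)" if "B \<in> sets borel" for B
    using integrable_mult_indicator[of B unif h] h(1) that by simp
  have meas: "measure ?N B = (\<integral>u. indicator B u * h u \<partial>unif)" if [measurable]: "B \<in> sets borel" for B
  proof -
    have "emeasure ?N B = (\<integral>\<^sup>+u. ennreal (indicator B u * h u) \<partial>unif)"
      by (subst emeasure_density) (auto intro!: nn_integral_cong simp: indicator_def)
    also have "\<dots> = ennreal (\<integral>u. indicator B u * h u \<partial>unif)"
      using h int_h[OF that] by (intro nn_integral_eq_integral) auto
    finally show ?thesis using h(2) by (simp add: measure_def)
  qed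
  have "emeasure ?N (space ?N) = 1"
    using h by (subst emeasure_density) (auto simp: nn_integral_eq_integral)
  then interpret N: prob_space ?N by (rule prob_spaceI)
  interpret N: cdf_distribution ?N
    by unfold_locales auto
  have null: "measure ?N B = 0" if "B \<in> sets borel" "AE u in unif. u \<notin> B" for B
  proof -
    have "measure ?N B = (\<integral>u. 0 \<partial>unif)"
      unfolding meas[OF that(1)] using that h by (intro integral_cong_AE) (auto elim!: eventually_mono)
    then show ?thesis by simp
  qed
  have AEunif: "AE u in unif. P u" if "AE u in lborel. u \<in> {-1..1} \<longrightarrow> P u" for P
    using that unfolding unif_def by (intro AE_uniform_measureI) auto
  have cdfm1: "cdf ?N u = 0" if "u \<le> -1" for u
    unfolding cdf_def using that AE_lborel_singleton[of "-1"]
    by (intro null AEunif) (auto elim!: eventually_mono)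
  have cdf1: "cdf ?N 1 = 1"
  proof -
    have "measure ?N (UNIV - {..1}) = 0"
      by (intro null AEunif) auto
    then show ?thesis using N.prob_compl[of "{..1}"] by (simp add: cdf_def)
  qed
  \<comment> \<open>Only an atom could make the distribution function jump over \<omega>. To the
    left of the quantile it stays at most \<omega>, the point itself has mass 0, and the reverse
    inequality is the defining property of the quantile.\<close>
  have CI: "cdf ?N (N.I \<omega>) = \<omega>" if \<omega>: "\<omega> \<in> {0<..<1}" for \<omega>
  proof (rule antisym)
    have "(cdf ?N \<longlongrightarrow> measure ?N {..<N.I \<omega>}) (at_left (N.I \<omega>))"
      by (rule N.cdf_at_left)
    moreover have "\<forall>\<^sub>F x in at_left (N.I \<omega>). cdf ?N x \<le> \<omega>"
    proof -
      have "cdf ?N x \<le> \<omega>" if "x < N.I \<omega>" for x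
        using N.pseudoinverse[of \<omega> x] \<omega> that by auto
      then show ?thesis by (simp add: eventually_at_filter)
    qed
    ultimately have "measure ?N {..<N.I \<omega>} \<le> \<omega>"
      by (intro tendsto_upperbound) auto
    moreover have "measure ?N {N.I \<omega>} = 0"
      using AE_lborel_singleton[of "N.I \<omega>"] by (intro null AEunif) (auto elim!: eventually_mono)
    ultimately show "cdf ?N (N.I \<omega>) \<le> \<omega>"
      unfolding cdf_def ivl_disj_un(2)[symmetric] by (subst N.finite_measure_Union) auto
    show "\<omega> \<le> cdf ?N (N.I \<omega>)" using N.pseudoinverse[of \<omega> "N.I \<omega>"] \<omega> by simp
  qed
    have I: "N.I \<omega> \<in> {-1..1}" if "\<omega> \<in> {0<..<1}" for \<omega>
    proof -
      have "N.I \<omega> \<le> 1" using N.pseudoinverse[of \<omega> 1] cdf1 that by simp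
      moreover have "\<not> N.I \<omega> \<le> -1" using CI[OF that] cdfm1[of "N.I \<omega>"] that by auto
      ultimately show ?thesis by simp
    qed
    have disp: "\<bar>2 * \<omega> - 1 - N.I \<omega>\<bar> \<le> 2 * (\<integral>u. \<bar>h u - 1\<bar> \<partial>unif)" if "\<omega> \<in> {0<..<1}" for \<omega>
    proof -
      let ?x = "N.I \<omega>"
      have int_1: "integrable unif (indicator {..?x} :: real \<Rightarrow> real)"
        by (intro integrable_real_indicator) (auto simp: less_top[symmetric] U.emeasure_eq_measure)
      have arith: "2 * w - 1 - x = 2 * (k - j)" if "m = (1 + x) / 2" "m = j" "w = k" for w x k j m :: real
        using that by simp
      have "measure unif {..?x} = (1 + ?x) / 2"
      proof -
        have "{-1..1} \<inter> {..?x} = {-1..?x}" using I[OF that] by auto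
        then have "emeasure unif {..?x} = ennreal (1 + ?x) / ennreal 2"
          using I[OF that] by (simp add: emeasure_unif add.commute)
        also have "\<dots> = ennreal ((1 + ?x) / 2)"
          using I[OF that] by (intro divide_ennreal) auto
        finally show ?thesis
          using I[OF that] by (simp add: measure_def)
      qed
      moreover have "measure unif {..?x} = (\<integral>u. indicator {..?x} u \<partial>unif)" by simp
      moreover have "\<omega> = (\<integral>u. indicator {..?x} u * h u \<partial>unif)"
        using CI[OF that] meas[of "{..?x}"] by (simp add: cdf_def)
      ultimately have "2 * \<omega> - 1 - ?x = 2 * ((\<integral>u. indicator {..?x} u * h u \<partial>unif) - (\<integral>u. indicator {..?x} u \<partial>unif))"
        by (rule arith)
      also have "(\<integral>u. indicator {..?x} u * h u \<partial>unif) - (\<integral>u. indicator {..?x} u \<partial>unif) = (\<integral>u. indicator {..?x} u * h u - indicator {..?x} u \<partial>unif)"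
        using int_h[of "{..?x}"] int_1 by (subst Bochner_Integration.integral_diff) auto
      finally have "\<bar>2 * \<omega> - 1 - ?x\<bar> = 2 * \<bar>\<integral>u. indicator {..?x} u * h u - indicator {..?x} u \<partial>unif\<bar>" by simp
      also have "\<bar>\<integral>u. indicator {..?x} u * h u - indicator {..?x} u \<partial>unif\<bar> \<le> (\<integral>u. \<bar>h u - 1\<bar> \<partial>unif)"
      proof (rule order_trans[OF integral_abs_bound])
        show "(\<integral>u. \<bar>indicator {..?x} u * h u - indicator {..?x} u\<bar> \<partial>unif) \<le> (\<integral>u. \<bar>h u - 1\<bar> \<partial>unif)"
          using h(1) int_h[of "{..?x}"] int_1 by (intro integral_mono) (auto split: split_indicator)
      qed
      finally show ?thesis by simp
    qed
  show ?thesis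
    by (rule that[OF N.measurable_CI N.distr_I_eq_M I disp])
qed

lemma W2_squared_le:
  "coupling \<mu> \<nu> \<pi> \<Longrightarrow> W2_squared \<mu> \<nu> \<le> quadratic_cost \<pi>"
  unfolding W2_squared_def by (intro INF_lower) auto

lemma coupling_distr:
  fixes X Y :: "'a \<Rightarrow> 'b::euclidean_space"
  assumes "X \<in> borel_measurable M" "Y \<in> borel_measurable M"
  shows "coupling (distr M borel X) (distr M borel Y) (distr M borel (\<lambda>\<omega>. (X \<omega>, Y \<omega>)))"
proof -
  have [measurable]: "(\<lambda>\<omega>. (X \<omega>, Y \<omega>)) \<in> borel_measurable M"
    using assms by (rule borel_measurable_Pair)
  have [measurable]: "fst \<in> borel_measurable (borel :: ('b \<times> 'b) measure)"
    "snd \<in> borel_measurable (borel :: ('b \<times> 'b) measure)"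
    by (auto intro!: borel_measurable_continuous_onI continuous_intros)
  show ?thesis
    unfolding coupling_def by (simp add: distr_distr comp_def)
qed

text \<open>Both measures are driven by the same \<omega>, through their quantile functions followed
  by \<gamma>. The displacement is bounded uniformly in \<omega>, so the squared cost is quadratic
  in the total variation, the order that Pinsker's inequality controls by the entropy.\<close>

lemma W2_squared_lipschitz_curve_le:
  fixes h :: "real \<Rightarrow> real" and \<gamma> :: "real \<Rightarrow> 'a::euclidean_space"
  assumes h: "integrable unif h" "\<And>u. 0 \<le> h u" "(\<integral>u. h u \<partial>unif) = 1"
    and [measurable]: "\<gamma> \<in> borel_measurable borel" and \<gamma>: "L-lipschitz_on {-1..1} \<gamma>"
  shows "W2_squared (distr unif borel \<gamma>) (distr (density unif h) borel \<gamma>)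
      \<le> ennreal ((2 * L * (\<integral>u. \<bar>h u - 1\<bar> \<partial>unif))\<^sup>2)"
proof -
  obtain I where I: "I \<in> borel_measurable (restrict_space borel {0<..<1})"
    "distr (restrict_space lborel {0<..<1}) borel I = density unif h"
    "\<And>\<omega>. \<omega> \<in> {0<..<1} \<Longrightarrow> I \<omega> \<in> {-1..1}"
    "\<And>\<omega>. \<omega> \<in> {0<..<1} \<Longrightarrow> \<bar>2 * \<omega> - 1 - I \<omega>\<bar> \<le> 2 * (\<integral>u. \<bar>h u - 1\<bar> \<partial>unif)"
    using quantile_displacement_le[OF h] by blast
  let ?R = "restrict_space lborel {0<..<1::real}" and ?A = "\<integral>u. \<bar>h u - 1\<bar> \<partial>unif"
  have L: "0 \<le> L" by (rule lipschitz_on_nonneg[OF \<gamma>])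
  have [measurable]: "I \<in> ?R \<rightarrow>\<^sub>M borel"
    using I(1) measurable_cong_sets[OF sets_restrict_space_cong[OF sets_lborel] refl] by blast
  have [measurable]: "(\<lambda>\<omega>::real. 2 * \<omega> - 1) \<in> ?R \<rightarrow>\<^sub>M borel"
    by (intro measurable_restrict_space1) auto
  define \<pi> where "\<pi> = distr ?R borel (\<lambda>\<omega>. (\<gamma> (2 * \<omega> - 1), \<gamma> (I \<omega>)))"
  have pair[measurable]: "(\<lambda>\<omega>. (\<gamma> (2 * \<omega> - 1), \<gamma> (I \<omega>))) \<in> ?R \<rightarrow>\<^sub>M borel"
    by (intro borel_measurable_Pair) measurable
  have "coupling (distr ?R borel (\<lambda>\<omega>. \<gamma> (2 * \<omega> - 1))) (distr ?R borel (\<lambda>\<omega>. \<gamma> (I \<omega>))) \<pi>"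
    unfolding \<pi>_def by (intro coupling_distr) measurable
  moreover have "distr ?R borel (\<lambda>\<omega>. \<gamma> (2 * \<omega> - 1)) = distr unif borel \<gamma>"
    by (subst distr_unit_interval_eq_unif[symmetric], subst distr_distr) (auto simp: comp_def)
  moreover have "distr ?R borel (\<lambda>\<omega>. \<gamma> (I \<omega>)) = distr (density unif h) borel \<gamma>"
    by (subst I(2)[symmetric], subst distr_distr) (auto simp: comp_def)
  ultimately have "W2_squared (distr unif borel \<gamma>) (distr (density unif h) borel \<gamma>) \<le> quadratic_cost \<pi>"
    by (simp add: W2_squared_le)
  also have "quadratic_cost \<pi> = (\<integral>\<^sup>+\<omega>. ennreal ((norm (\<gamma> (2 * \<omega> - 1) - \<gamma> (I \<omega>)))\<^sup>2) \<partial>?R)"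
    unfolding quadratic_cost_def \<pi>_def
    by (subst nn_integral_distr) (auto simp: case_prod_unfold intro!: borel_measurable_continuous_onI continuous_intros)
  also have "\<dots> \<le> (\<integral>\<^sup>+\<omega>. ennreal ((2 * L * ?A)\<^sup>2) \<partial>?R)"
  proof (rule nn_integral_mono)
    fix \<omega> assume "\<omega> \<in> space ?R"
    then have \<omega>: "\<omega> \<in> {0<..<1}" by (simp add: space_restrict_space)
    have "norm (\<gamma> (2 * \<omega> - 1) - \<gamma> (I \<omega>)) \<le> L * \<bar>2 * \<omega> - 1 - I \<omega>\<bar>"
      using lipschitz_onD[OF \<gamma>, of "2 * \<omega> - 1" "I \<omega>"] \<omega> I(3)[OF \<omega>] by (auto simp: dist_norm)
    also have "\<dots> \<le> L * (2 * ?A)" by (intro mult_left_mono I L \<omega>)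
    finally show "ennreal ((norm (\<gamma> (2 * \<omega> - 1) - \<gamma> (I \<omega>)))\<^sup>2) \<le> ennreal ((2 * L * ?A)\<^sup>2)"
      by (intro ennreal_leI power_mono) (auto simp: ac_simps)
  qed
  also have "\<dots> = ennreal ((2 * L * ?A)\<^sup>2)"
    by (simp add: space_restrict_space emeasure_restrict_space)
  finally show ?thesis .
qed

text \<open>
  For the uniform measure on an interval the \<open>L\<^sup>\<infinity>\<close> norm of the quantile displacement is the
  Kolmogorov distance up to a factor, and Pinsker's inequality bounds that distance by the square
  root of the entropy.
\<close>

lemma talagrand_const_lipschitz_curve_finite:
  fixes \<gamma> :: "real \<Rightarrow> 'a::euclidean_space"
  assumes \<gamma>m[measurable]: "\<gamma> \<in> borel_measurable borel" and \<gamma>: "L-lipschitz_on {-1..1} \<gamma>"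
  shows "talagrand_const (distr unif borel \<gamma>) < \<top>"
proof -
  interpret U: prob_space unif by (rule prob_space_unif)
  let ?\<mu> = "distr unif borel \<gamma>"
  interpret M: prob_space ?\<mu> by (rule U.prob_space_distr) simp
  \<comment> \<open>16 L^2 is (2L)^2 times the constant 4 of Pinsker's inequality. The added 1 keeps
    the factor positive for L = 0, so that its product with infinite entropy is
    \<open>\<top>\<close>.\<close>
  have "W2_squared ?\<mu> \<nu> \<le> ennreal (16 * L\<^sup>2 + 1) * rel_entropy \<nu> ?\<mu>"
    if \<nu>: "prob_space \<nu>" "sets \<nu> = sets borel" for \<nu>
  proof (cases "absolutely_continuous ?\<mu> \<nu> \<and> integrable \<nu> (entropy_density (exp 1) ?\<mu> \<nu>)")
    case True
    interpret N: prob_space \<nu> by fact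
    have sets: "sets \<nu> = sets ?\<mu>" using \<nu> by simp
    obtain D where D[measurable]: "D \<in> borel_measurable ?\<mu>"
      and DRN: "AE x in ?\<mu>. RN_deriv ?\<mu> \<nu> x = ennreal (D x)" and D0: "\<And>x. 0 \<le> D x"
      using M.real_RN_deriv[OF N.finite_measure_axioms _ sets] True by metis
    have [measurable]: "D \<in> borel_measurable borel" using D by simp
    have "\<nu> = density ?\<mu> (RN_deriv ?\<mu> \<nu>)"
      using M.density_RN_deriv[OF _ sets] True by simp
    also have "\<dots> = density ?\<mu> D"
      using DRN by (intro density_cong) auto
    finally have \<nu>D: "\<nu> = density ?\<mu> D" .
    have "integrable \<nu> (\<lambda>x. log (exp 1) (D x))"
    proof (rule integrable_cong_AE[THEN iffD1, OF _ _ _ conjunct2[OF True]])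
      have "AE x in \<nu>. RN_deriv ?\<mu> \<nu> x = ennreal (D x)"
        using absolutely_continuous_AE[OF sets _ DRN] True by simp
      then show "AE x in \<nu>. entropy_density (exp 1) ?\<mu> \<nu> x = log (exp 1) (D x)"
        by eventually_elim (simp add: entropy_density_def D0)
    qed (use measurable_entropy_density[of "exp 1" ?\<mu> \<nu>] sets in \<open>simp_all cong: measurable_cong_sets\<close>)
    then have int: "integrable ?\<mu> (\<lambda>x. D x * ln (D x))"
      unfolding \<nu>D using D0 by (subst (asm) integrable_real_density) (auto simp: log_def)
    have "KL_divergence (exp 1) ?\<mu> \<nu> = (\<integral>x. D x * log (exp 1) (D x) \<partial>?\<mu>)"
      unfolding \<nu>D by (rule M.KL_density) (auto simp: D0)
    then have KL: "KL_divergence (exp 1) ?\<mu> \<nu> = (\<integral>x. D x * ln (D x) \<partial>?\<mu>)"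
      by (simp add: log_def)
    have "(\<integral>\<^sup>+x. ennreal (D x) \<partial>?\<mu>) = 1"
      using N.emeasure_space_1 unfolding \<nu>D by (simp add: emeasure_density)
    then have Dint: "integrable ?\<mu> D" and D1: "(\<integral>x. D x \<partial>?\<mu>) = 1"
      using D0 by (auto intro!: integrableI_nonneg simp: integral_eq_nn_integral)
    define A where "A = (\<integral>x. \<bar>D x - 1\<bar> \<partial>?\<mu>)"
    have A: "A\<^sup>2 \<le> 4 * KL_divergence (exp 1) ?\<mu> \<nu>"
      unfolding A_def KL by (rule M.pinsker) (use Dint D0 D1 int in auto)
    \<comment> \<open>A density with respect to the image measure is pulled back along \<gamma>;
      entropy and total variation are unchanged by this, whether or not \<gamma> is
      injective.\<close>
    have "\<nu> = distr (density unif (\<lambda>u. D (\<gamma> u))) borel \<gamma>"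
      unfolding \<nu>D by (subst density_distr) auto
    then have "W2_squared ?\<mu> \<nu> \<le> ennreal ((2 * L * (\<integral>u. \<bar>D (\<gamma> u) - 1\<bar> \<partial>unif))\<^sup>2)"
      using Dint D1 D0 by (auto simp: integrable_distr_eq integral_distr intro!: W2_squared_lipschitz_curve_le[OF _ _ _ \<gamma>m \<gamma>])
    also have "(\<integral>u. \<bar>D (\<gamma> u) - 1\<bar> \<partial>unif) = A"
      unfolding A_def by (subst integral_distr) auto
    also have "ennreal ((2 * L * A)\<^sup>2) \<le> ennreal ((16 * L\<^sup>2 + 1) * KL_divergence (exp 1) ?\<mu> \<nu>)"
    proof (rule ennreal_leI)
      have "0 \<le> KL_divergence (exp 1) ?\<mu> \<nu>" using A zero_le_power2[of A] by linarith
      moreover have "(2 * L * A)\<^sup>2 \<le> 4 * L\<^sup>2 * (4 * KL_divergence (exp 1) ?\<mu> \<nu>)"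
        using mult_left_mono[OF A, of "4 * L\<^sup>2"] by (simp add: power_mult_distrib)
      ultimately show "(2 * L * A)\<^sup>2 \<le> (16 * L\<^sup>2 + 1) * KL_divergence (exp 1) ?\<mu> \<nu>"
        by (simp add: algebra_simps)
    qed
    also have "\<dots> = ennreal (16 * L\<^sup>2 + 1) * rel_entropy \<nu> ?\<mu>"
      using True by (simp add: rel_entropy_def ennreal_mult')
    finally show ?thesis .
  next
    case False
    have "ennreal (16 * L\<^sup>2 + 1) \<noteq> 0"
      using zero_le_power2[of L] by (simp add: ennreal_eq_0_iff not_le add_nonneg_pos)
    then show ?thesis
      unfolding rel_entropy_def if_not_P[OF False] by (simp add: ennreal_mult_top)
  qed
  then have "talagrand_const ?\<mu> \<le> ennreal (16 * L\<^sup>2 + 1)"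
    unfolding talagrand_const_def by (intro Inf_lower) auto
  also have "\<dots> < \<top>" by simp
  finally show ?thesis .
qed

section \<open>The Poincare inequality\<close>

text \<open>Convexity on the open half-line gives the tangent bound for positive \<open>x\<close>;
  at \<open>x = 0\<close> the tangent has the value (1-p) c^p, which is at most 0.\<close>

lemma powr_above_tangent:
  fixes x c p :: real
  assumes "1 \<le> p" "0 \<le> x" "0 < c"
  shows "c powr p + p * c powr (p - 1) * (x - c) \<le> x powr p"
proof (cases "x = 0")
  case True
  have "c powr p = c * c powr (p - 1)" using assms by (simp add: powr_mult_base)
  then have "c powr p + p * c powr (p - 1) * (0 - c) = (1 - p) * c powr p"
    by (simp add: algebra_simps)
  also have "\<dots> \<le> 0" using assms by (intro mult_nonpos_nonneg) auto
  finally show ?thesis using True by simp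
next
  case False
  have "(p * c powr (p - 1)) * (x - c) \<le> x powr p - c powr p"
  proof (rule convex_on_imp_above_tangent[OF powr_convex[OF assms(1)]])
    show "((\<lambda>x. x powr p) has_real_derivative p * c powr (p - 1)) (at c within {0<..})"
      using assms by (intro DERIV_subset[OF has_real_derivative_powr]) auto
  qed (use assms False in \<open>auto simp: interior_open\<close>)
  then show ?thesis by simp
qed

text \<open>Jensen's inequality, by integrating the tangent at the mean. The values in
  \<open>ennreal\<close> avoid assuming that the power is integrable.\<close>

lemma (in prob_space) powr_expectation_le:
  assumes k: "integrable M k" "\<And>x. 0 \<le> k x" and p: "1 \<le> p"
  shows "ennreal ((\<integral>x. k x \<partial>M) powr p) \<le> (\<integral>\<^sup>+x. ennreal (k x powr p) \<partial>M)"
proof (cases "(\<integral>\<^sup>+x. ennreal (k x powr p) \<partial>M) = \<top> \<or> (\<integral>x. k x \<partial>M) = 0")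
  case True
  then show ?thesis by auto
next
  case False
  define c where "c = (\<integral>x. k x \<partial>M)"
  have "c \<ge> 0" unfolding c_def using k by (intro integral_nonneg_AE) auto
  with False have "c > 0" by (simp add: c_def)
  have [measurable]: "k \<in> borel_measurable M" using k by auto
  have int: "integrable M (\<lambda>x. k x powr p)"
    using False by (intro integrableI_nonneg) (auto simp: less_top)
  have "c powr p = (\<integral>x. c powr p + p * c powr (p - 1) * (k x - c) \<partial>M)"
    using k by (simp add: prob_space c_def)
  also have "\<dots> \<le> (\<integral>x. k x powr p \<partial>M)"
    using k int p \<open>c > 0\<close> by (intro integral_mono powr_above_tangent) auto
  finally have "ennreal (c powr p) \<le> ennreal (\<integral>x. k x powr p \<partial>M)" by (rule ennreal_leI)
  also have "\<dots> = (\<integral>\<^sup>+x. ennreal (k x powr p) \<partial>M)"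
    using int by (intro nn_integral_eq_integral[symmetric]) auto
  finally show ?thesis by (simp add: c_def)
qed

text \<open>The fundamental theorem of calculus along the segment, with Cauchy-Schwarz for the
  directional derivative. The integral is enlarged from [0,u] to [0,1] to make the bound uniform in
  \<open>u\<close>.\<close>

lemma poincare_test_diff_le:
  fixes f :: "'a::euclidean_space \<Rightarrow> real"
  assumes fg: "poincare_test f g" and u: "u \<in> {0..1}"
  shows "ennreal \<bar>f (x + u *\<^sub>R d) - f x\<bar>
      \<le> ennreal (norm d) * (\<integral>\<^sup>+s. ennreal (norm (g (x + s *\<^sub>R d))) * indicator {0..1} s \<partial>lborel)"
proof -
  let ?k = "\<lambda>s. norm (g (x + s *\<^sub>R d))"
  have cg: "continuous_on A (\<lambda>s. g (x + s *\<^sub>R d))" for A :: "real set"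
  proof -
    have "continuous_on UNIV g" using fg by (simp add: poincare_test_def)
    then show ?thesis by (rule continuous_on_compose2) (auto intro!: continuous_intros)
  qed
  have der: "((\<lambda>s. f (x + s *\<^sub>R d)) has_vector_derivative g (x + s *\<^sub>R d) \<bullet> d) (at s within A)" for s A
  proof -
    have "(f has_derivative (\<lambda>y. y \<bullet> g (x + s *\<^sub>R d))) (at (x + s *\<^sub>R d))"
      using fg by (simp add: poincare_test_def gderiv_def)
    then have "((\<lambda>s. f (x + s *\<^sub>R d)) has_derivative (\<lambda>h. (h *\<^sub>R d) \<bullet> g (x + s *\<^sub>R d))) (at s within A)"
      by (rule has_derivative_compose[rotated]) (auto intro!: derivative_eq_intros)
    then show ?thesis by (simp add: has_vector_derivative_def inner_commute)
  qed
  have "((\<lambda>s. g (x + s *\<^sub>R d) \<bullet> d) has_integral f (x + u *\<^sub>R d) - f (x + 0 *\<^sub>R d)) {0..u}"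
    using u der by (intro fundamental_theorem_of_calculus) auto
  then have "\<bar>f (x + u *\<^sub>R d) - f x\<bar> = \<bar>integral {0..u} (\<lambda>s. g (x + s *\<^sub>R d) \<bullet> d)\<bar>"
    by (simp add: integral_unique)
  also have "\<dots> \<le> integral {0..u} (\<lambda>s. norm d * ?k s)"
  proof -
    have "norm (integral {0..u} (\<lambda>s. g (x + s *\<^sub>R d) \<bullet> d)) \<le> integral {0..u} (\<lambda>s. norm d * ?k s)"
      by (intro integral_norm_bound_integral integrable_continuous_real continuous_intros cg)
        (simp add: Cauchy_Schwarz_ineq2 mult.commute[of "norm d"])
    then show ?thesis by simp
  qed
  also have "\<dots> \<le> integral {0..1} (\<lambda>s. norm d * ?k s)"
    using u by (intro integral_subset_le integrable_continuous_real continuous_intros cg) auto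
  also have "\<dots> = norm d * integral {0..1} ?k"
    by (rule integral_mult_right)
  finally have "ennreal \<bar>f (x + u *\<^sub>R d) - f x\<bar> \<le> ennreal (norm d * integral {0..1} ?k)"
    by (rule ennreal_leI)
  also have "\<dots> = ennreal (norm d) * ennreal (integral {0..1} ?k)"
    by (simp add: ennreal_mult')
  also have "ennreal (integral {0..1} ?k) = (\<integral>\<^sup>+s. ennreal (?k s * indicator {0..1} s) \<partial>lborel)"
  proof (rule nn_integral_has_integral_lborel[symmetric])
    have "(?k has_integral integral {0..1} ?k) {0..1}"
      by (intro integrable_integral integrable_continuous_real continuous_intros cg)
    then show "((\<lambda>s. ?k s * indicator {0..1} s) has_integral integral {0..1} ?k) UNIV"
    proof (subst (asm) has_integral_restrict_UNIV[symmetric])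
      have "(\<lambda>s. ?k s * indicator {0..1} s) = (\<lambda>s. if s \<in> {0..1} then ?k s else 0)"
        by (auto simp: indicator_def)
      then show "((\<lambda>s. if s \<in> {0..1} then ?k s else 0) has_integral integral {0..1} ?k) UNIV \<Longrightarrow> ?thesis"
        by simp
    qed
    have "continuous_on UNIV ?k" by (intro continuous_intros cg)
    then show "(\<lambda>s. ?k s * indicator {0..1} s) \<in> borel_measurable borel"
      by (intro borel_measurable_times borel_measurable_continuous_onI borel_measurable_indicator) auto
  qed simp
  also have "\<dots> = (\<integral>\<^sup>+s. ennreal (?k s) * indicator {0..1} s \<partial>lborel)"
    by (intro nn_integral_cong) (auto simp: indicator_def)
  finally show ?thesis .
qed

text \<open>With \<open>a = f v\<close> the oscillation along the curve is at most a multiple of the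
  mean \<open>K\<close> of the gradient norm, uniformly in the parameter. Taking p-th powers leaves
  \<open>K powr p\<close>, which Jensen's inequality bounds by the mean of the p-th powers.\<close>

lemma poincare_const_vee_finite:
  fixes v d d' :: "'a::euclidean_space"
  assumes p: "1 \<le> p"
  shows "poincare_const p (distr unif borel (vee v d d')) < \<top>"
proof -
  interpret U: prob_space unif by (rule prob_space_unif)
  let ?\<gamma> = "vee v d d'" and ?\<mu> = "distr unif borel (vee v d d')"
  interpret M: prob_space ?\<mu> by (rule U.prob_space_distr) simp
  \<comment> \<open>The factor 2 undoes the density 1/2 of \<open>unif\<close> on [-1,1].\<close>
  define L where "L = 2 * (norm d + norm d')"
  have "L \<ge> 0" by (simp add: L_def)
  have "(INF a::real. \<integral>\<^sup>+x. ennreal (\<bar>f x - a\<bar> powr p) \<partial>?\<mu>)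
      \<le> ennreal (L powr p) * (\<integral>\<^sup>+x. ennreal (norm (g x) powr p) \<partial>?\<mu>)"
    if fg: "poincare_test f g" for f g
  proof -
    have cg: "continuous_on UNIV g" using fg by (simp add: poincare_test_def)
    have [measurable]: "g \<in> borel_measurable borel" using cg by (rule borel_measurable_continuous_onI)
    have "continuous_on UNIV f"
      using fg unfolding poincare_test_def gderiv_def
      by (intro differentiable_imp_continuous_on) (auto simp: differentiable_on_def differentiable_def intro: has_derivative_at_withinI)
    then have [measurable]: "f \<in> borel_measurable borel" by (rule borel_measurable_continuous_onI)
    let ?k = "\<lambda>u. norm (g (?\<gamma> u))"
    have "continuous_on {-1..1} ?k"
      by (intro continuous_intros continuous_on_compose2[OF cg continuous_on_vee]) auto
    then have "bounded (?k ` {-1..1})"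
      by (intro compact_imp_bounded compact_continuous_image) auto
    then obtain B where B: "\<And>u. u \<in> {-1..1} \<Longrightarrow> ?k u \<le> B"
      unfolding bounded_iff by force
    have AE_unif: "AE u in unif. u \<in> {-1..1}"
      unfolding unif_def by (intro AE_uniform_measureI) auto
    have intk: "integrable unif ?k"
      by (intro U.integrable_const_bound[of _ B] eventually_mono[OF AE_unif]) (simp_all add: B)
    define K where "K = (\<integral>u. ?k u \<partial>unif)"
    have K: "0 \<le> K" "(\<integral>\<^sup>+u. ennreal (?k u) \<partial>unif) = ennreal K"
      unfolding K_def using intk by (auto intro!: nn_integral_eq_integral)
    \<comment> \<open>The sign \<open>c\<close> selects the arm: each arm uses half of the parameter
      interval, and its integral is bounded by the one over the whole interval.\<close>
    have half: "(\<integral>\<^sup>+s. ennreal (?k (c * s)) * indicator {0..1} s \<partial>lborel) \<le> ennreal (2 * K)"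
      if c: "c = 1 \<or> c = -1" for c :: real
    proof -
      have "(\<integral>\<^sup>+s. ennreal (?k (c * s)) * indicator {0..1} s \<partial>lborel)
          \<le> (\<integral>\<^sup>+s. ennreal (?k (c * s)) * indicator {-1..1} (c * s) \<partial>lborel)"
        using c by (intro nn_integral_mono) (auto simp: indicator_def)
      also have "\<dots> = (\<integral>\<^sup>+s. ennreal (?k s) * indicator {-1..1} s \<partial>lborel)"
        using c nn_integral_real_affine[of "\<lambda>s. ennreal (?k s) * indicator {-1..1} s" c 0] by auto
      also have "\<dots> = 2 * (\<integral>\<^sup>+u. ennreal (?k u) \<partial>unif)"
        by (subst nn_integral_unif) (simp_all add: ennreal_two_times_half)
      also have "\<dots> = ennreal (2 * K)"
        using K by (simp add: ennreal_mult')
      finally show ?thesis .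
    qed
    have diff: "\<bar>f (?\<gamma> u) - f v\<bar> \<le> L * K" if u: "u \<in> {-1..1}" for u
    proof -
      have "ennreal \<bar>f (?\<gamma> u) - f v\<bar> \<le> ennreal (norm d + norm d') * ennreal (2 * K)"
      proof (cases "0 \<le> u")
        case True
        have eq: "v + s *\<^sub>R d = ?\<gamma> (1 * s)" if "s \<in> {0..1}" for s
          using that by (simp add: vee_def)
        have "ennreal \<bar>f (v + u *\<^sub>R d) - f v\<bar> \<le> ennreal (norm d) * (\<integral>\<^sup>+s. ennreal (norm (g (v + s *\<^sub>R d))) * indicator {0..1} s \<partial>lborel)"
          using True u by (intro poincare_test_diff_le[OF fg]) auto
        also have "(\<integral>\<^sup>+s. ennreal (norm (g (v + s *\<^sub>R d))) * indicator {0..1} s \<partial>lborel)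
          = (\<integral>\<^sup>+s. ennreal (?k (1 * s)) * indicator {0..1} s \<partial>lborel)"
          using eq by (intro nn_integral_cong) (simp split: split_indicator)
        also have "ennreal (norm d) * \<dots> \<le> ennreal (norm d + norm d') * ennreal (2 * K)"
          by (intro mult_mono half ennreal_leI) auto
        finally show ?thesis using True by (simp add: vee_def)
      next
        case False
        have eq: "v + s *\<^sub>R d' = ?\<gamma> ((-1) * s)" if "s \<in> {0..1}" for s
          using that by (simp add: vee_def)
        have "ennreal \<bar>f (v + (-u) *\<^sub>R d') - f v\<bar> \<le> ennreal (norm d') * (\<integral>\<^sup>+s. ennreal (norm (g (v + s *\<^sub>R d'))) * indicator {0..1} s \<partial>lborel)"
          using False u by (intro poincare_test_diff_le[OF fg]) auto
        also have "(\<integral>\<^sup>+s. ennreal (norm (g (v + s *\<^sub>R d'))) * indicator {0..1} s \<partial>lborel)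
          = (\<integral>\<^sup>+s. ennreal (?k ((-1) * s)) * indicator {0..1} s \<partial>lborel)"
          using eq by (intro nn_integral_cong) (simp split: split_indicator)
        also have "ennreal (norm d') * \<dots> \<le> ennreal (norm d + norm d') * ennreal (2 * K)"
          by (intro mult_mono half ennreal_leI) auto
        finally show ?thesis using False by (simp add: vee_def)
      qed
      also have "\<dots> = ennreal (L * K)"
        unfolding L_def using K by (subst ennreal_mult[symmetric]) (auto simp: algebra_simps)
      finally show ?thesis using K \<open>L \<ge> 0\<close> by (subst (asm) ennreal_le_iff) auto
    qed
    have "(INF a::real. \<integral>\<^sup>+x. ennreal (\<bar>f x - a\<bar> powr p) \<partial>?\<mu>) \<le> (\<integral>\<^sup>+x. ennreal (\<bar>f x - f v\<bar> powr p) \<partial>?\<mu>)"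
      by (rule INF_lower) simp
    also have "\<dots> = (\<integral>\<^sup>+u. ennreal (\<bar>f (?\<gamma> u) - f v\<bar> powr p) \<partial>unif)"
      by (subst nn_integral_distr) auto
    also have "\<dots> \<le> (\<integral>\<^sup>+u. ennreal ((L * K) powr p) \<partial>unif)"
      by (intro nn_integral_mono_AE eventually_mono[OF AE_unif] ennreal_leI powr_mono2 diff) (use p in auto)
    also have "\<dots> = ennreal ((L * K) powr p)"
      using U.emeasure_space_1 by simp
    also have "\<dots> = ennreal (L powr p) * ennreal (K powr p)"
      using K \<open>L \<ge> 0\<close> by (simp add: powr_mult ennreal_mult')
    also have "\<dots> \<le> ennreal (L powr p) * (\<integral>\<^sup>+u. ennreal (?k u powr p) \<partial>unif)"
      unfolding K_def using intk p by (intro mult_left_mono U.powr_expectation_le) auto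
    also have "(\<integral>\<^sup>+u. ennreal (?k u powr p) \<partial>unif) = (\<integral>\<^sup>+x. ennreal (norm (g x) powr p) \<partial>?\<mu>)"
      by (subst nn_integral_distr) auto
    finally show ?thesis .
  qed
  then have "poincare_const p ?\<mu> \<le> ennreal (L powr p)"
    unfolding poincare_const_def by (intro Inf_lower) auto
  also have "\<dots> < \<top>" by simp
  finally show ?thesis .
qed

section \<open>Measures with disconnected support\<close>

text \<open>Squaring removes the kink of \<open>max 0\<close> at 0: the difference quotient there is
  bounded by \<bar>h\<bar>.\<close>

lemma has_real_derivative_max_zero_square:
  "((\<lambda>y::real. (max 0 y)\<^sup>2) has_real_derivative 2 * max 0 y) (at y)"
proof -
  consider "y > 0" | "y < 0" | "y = 0" by linarith
  then show ?thesis
  proof cases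
    case 1
    have "((\<lambda>y::real. y\<^sup>2) has_real_derivative 2 * y) (at y)"
      by (auto intro!: derivative_eq_intros)
    then have "((\<lambda>y::real. (max 0 y)\<^sup>2) has_real_derivative 2 * y) (at y)"
      by (rule has_field_derivative_transform_within_open[where S = "{0<..}"]) (use 1 in auto)
    then show ?thesis using 1 by (simp add: max_def)
  next
    case 2
    have "((\<lambda>y::real. 0) has_real_derivative 0) (at y)" by simp
    then have "((\<lambda>y::real. (max 0 y)\<^sup>2) has_real_derivative 0) (at y)"
      by (rule has_field_derivative_transform_within_open[where S = "{..<0}"]) (use 2 in auto)
    then show ?thesis using 2 by (simp add: max_def)
  next
    case 3
    have "((\<lambda>h::real. (max 0 h)\<^sup>2 / h) \<longlongrightarrow> 0) (at 0)"
    proof (rule Lim_null_comparison)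
      have "norm ((max 0 h)\<^sup>2 / h) \<le> \<bar>h\<bar>" for h :: real
        by (auto simp: max_def power2_eq_square)
      then show "\<forall>\<^sub>F h in at 0. norm ((max 0 h)\<^sup>2 / h) \<le> \<bar>h::real\<bar>" by simp
      show "((\<lambda>h::real. \<bar>h\<bar>) \<longlongrightarrow> 0) (at 0)" by (intro tendsto_eq_intros) auto
    qed
    then show ?thesis using 3 by (simp add: DERIV_def)
  qed
qed

text \<open>\<open>\<theta> (1 - \<theta> s)\<close> with \<open>\<theta> y = (max 0 y)\<^sup>2\<close> is a \<open>C\<^sup>1\<close> step function; composed with the squared
  distance to the centre of a large ball, it separates the two half-spaces near the origin.\<close>

lemma poincare_test_separating:
  fixes e :: "'a::euclidean_space"
  assumes e: "norm e = 1" and c: "c > 0"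
  obtains f g where "poincare_test f g"
    "\<And>x. (norm x)\<^sup>2 \<le> 2 \<Longrightarrow> c \<le> x \<bullet> e \<Longrightarrow> f x = 1 \<and> g x = 0"
    "\<And>x. x \<bullet> e \<le> - c \<Longrightarrow> f x = 0 \<and> g x = 0"
proof -
  \<comment> \<open>The ball has centre R e and radius R. By
    \<open>q x = (norm x)\<^sup>2 - 2 * R * (x \<bullet> e)\<close> and R = 1/c, points with squared
    norm at most 2 and x \<bullet> e at least c have q at most 2 - 2 = 0, while q is at least 2
    where x \<bullet> e is at most -c. A step function of x \<bullet> e alone would separate as
    well, but its gradient would not have compact support in dimension 2 or more.\<close>
  define R where "R = 1 / c"
  define q where "q x = (x - R *\<^sub>R e) \<bullet> (x - R *\<^sub>R e) - R\<^sup>2" for x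
  define \<psi> where "\<psi> s = (max 0 (1 - (max 0 s)\<^sup>2))\<^sup>2" for s :: real
  define \<psi>' where "\<psi>' s = - 4 * max 0 (1 - (max 0 s)\<^sup>2) * max 0 s" for s :: real
  define g where "g x = \<psi>' (q x) *\<^sub>R (2 *\<^sub>R (x - R *\<^sub>R e))" for x
  have q: "q x = (norm x)\<^sup>2 - 2 * R * (x \<bullet> e)" for x
  proof -
    have "e \<bullet> e = 1" using e by (simp add: dot_square_norm)
    then show ?thesis
      by (simp add: q_def inner_diff_left inner_diff_right inner_commute power2_norm_eq_inner)
        (simp add: power2_eq_square)
  qed
  have \<psi>: "(\<psi> has_real_derivative \<psi>' s) (at s)" for s
  proof -
    have "((\<lambda>s. 1 - (max 0 s)\<^sup>2) has_real_derivative - (2 * max 0 s)) (at s)" for s :: real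
      using DERIV_diff[OF DERIV_const[of 1] has_real_derivative_max_zero_square[of s]] by simp
    from DERIV_chain2[OF has_real_derivative_max_zero_square this[of s]] show ?thesis
      by (simp add: \<psi>_def[abs_def] \<psi>'_def mult.assoc)
  qed
  have qd: "GDERIV q x :> 2 *\<^sub>R (x - R *\<^sub>R e)" for x
    unfolding gderiv_def q_def
    by (rule derivative_eq_intros refl | simp add: inner_commute)+
  have zero: "\<psi>' s = 0" if "s \<le> 0 \<or> 1 \<le> s" for s
  proof (cases "s \<le> 0")
    case False
    then have "1 \<le> s\<^sup>2" using that by (simp add: power2_eq_square) (metis mult_mono' zero_le_one mult_1)
    then show ?thesis using False by (simp add: \<psi>'_def)
  qed (simp add: \<psi>'_def)
  have test: "poincare_test (\<lambda>x. \<psi> (q x)) g"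
    unfolding poincare_test_def
  proof (intro conjI allI)
    show "GDERIV (\<lambda>x. \<psi> (q x)) x :> g x" for x
      unfolding g_def by (rule GDERIV_DERIV_compose[OF qd \<psi>])
    show "continuous_on UNIV g"
      unfolding g_def \<psi>'_def q_def by (intro continuous_intros)
    \<comment> \<open>The gradient can be nonzero only where q is at most 1, which is again a ball
      around R e.\<close>
    have "norm x \<le> R + sqrt (R\<^sup>2 + 1)" if "g x \<noteq> 0" for x
    proof -
      have "q x \<le> 1" using that zero[of "q x"] by (force simp: g_def)
      then have "norm (x - R *\<^sub>R e) \<le> sqrt (R\<^sup>2 + 1)"
        by (intro real_le_rsqrt) (simp add: q_def dot_square_norm)
      moreover have "norm (R *\<^sub>R e) = R" using e c by (simp add: R_def)
      ultimately show ?thesis using norm_triangle_ineq[of "R *\<^sub>R e" "x - R *\<^sub>R e"] by simp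
    qed
    then have "bounded {x. g x \<noteq> 0}" by (auto simp: bounded_iff)
    then show "compact (closure {x. g x \<noteq> 0})" by simp
  qed
  show ?thesis
  proof (rule that[OF test])
    fix x assume x: "(norm x)\<^sup>2 \<le> 2" "c \<le> x \<bullet> e"
    then have "1 \<le> R * (x \<bullet> e)" using c by (simp add: R_def)
    then have "q x \<le> 0" using x by (simp add: q)
    then show "\<psi> (q x) = 1 \<and> g x = 0" using zero[of "q x"] by (simp add: \<psi>_def g_def)
  next
    fix x assume "x \<bullet> e \<le> - c"
    then have "R * (x \<bullet> e) \<le> - 1" using c by (simp add: R_def field_simps)
    moreover have "q x = (norm x)\<^sup>2 - 2 * (R * (x \<bullet> e))" by (simp add: q)
    ultimately have "1 \<le> q x" using zero_le_power2[of "norm x"] by linarith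
    moreover from this have "1 \<le> (q x)\<^sup>2" by simp
    ultimately show "\<psi> (q x) = 0 \<and> g x = 0" using zero[of "q x"] by (simp add: \<psi>_def g_def)
  qed
qed

text \<open>What both negative results use of an interior measure: mass 1/2 on either side of an
  empty slab of width 2c. The bound 2 is the one for a point whose two coordinates lie in
  [-1,1].\<close>

locale disconnected_measure = prob_space \<mu> for \<mu> :: "'a::euclidean_space measure" +
  fixes e :: 'a and c :: real
  assumes sets_eq [simp, measurable_cong]: "sets \<mu> = sets borel"
    and unit: "norm e = 1" and pos: "c > 0"
    and ball: "AE x in \<mu>. (norm x)\<^sup>2 \<le> 2"
    and gap: "AE x in \<mu>. c \<le> \<bar>x \<bullet> e\<bar>"
    and half: "prob {x. 0 < x \<bullet> e} = 1/2"
begin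

lemma space_eq [simp]: "space \<mu> = UNIV"
  using sets_eq_imp_space_eq[OF sets_eq] by simp

lemma halves_measurable [measurable]: "{x. 0 < x \<bullet> e} \<in> sets borel" "{x. \<not> 0 < x \<bullet> e} \<in> sets borel"
  by measurable

lemma other_half: "prob {x. \<not> 0 < x \<bullet> e} = 1/2"
proof -
  have "{x. \<not> 0 < x \<bullet> e} = space \<mu> - {x. 0 < x \<bullet> e}" by auto
  then show ?thesis using half prob_compl[of "{x. 0 < x \<bullet> e}"] by simp
qed

text \<open>Any number \<open>a\<close> is at distance at least 1/2 from one of the two values 0 and
  1 of the test function, each of which is taken on mass 1/2, while the gradient vanishes almost
  everywhere.\<close>

lemma poincare_const_eq_top:
  assumes p: "1 \<le> p"
  shows "poincare_const p \<mu> = \<top>"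
proof -
  obtain f g where fg: "poincare_test f g"
    and plus: "\<And>x. (norm x)\<^sup>2 \<le> 2 \<Longrightarrow> c \<le> x \<bullet> e \<Longrightarrow> f x = 1 \<and> g x = 0"
    and minus: "\<And>x. x \<bullet> e \<le> - c \<Longrightarrow> f x = 0 \<and> g x = 0"
    using poincare_test_separating[OF unit pos] by blast
  have AE: "AE x in \<mu>. f x = (if 0 < x \<bullet> e then 1 else 0) \<and> g x = 0"
    using ball gap
  proof eventually_elim
    case (elim x)
    then show ?case using plus[of x] minus[of x] pos by (cases "0 < x \<bullet> e") auto
  qed
  have "(\<integral>\<^sup>+x. ennreal (norm (g x) powr p) \<partial>\<mu>) = (\<integral>\<^sup>+x. 0 \<partial>\<mu>)"
    using AE by (intro nn_integral_cong_AE) (auto elim!: eventually_mono)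
  then have zero: "(\<integral>\<^sup>+x. ennreal (norm (g x) powr p) \<partial>\<mu>) = 0" by simp
  define z where "z = ennreal ((1/2) powr p * (1/2))"
  have bound: "z \<le> (\<integral>\<^sup>+x. ennreal (\<bar>f x - a\<bar> powr p) \<partial>\<mu>)"
    if A: "A \<in> sets \<mu>" "prob A = 1/2" "AE x in \<mu>. x \<in> A \<longrightarrow> 1/2 \<le> \<bar>f x - a\<bar>" for A a
  proof -
    have "emeasure \<mu> A = ennreal (1/2)" unfolding emeasure_eq_measure A(2) ..
    then have "z = (\<integral>\<^sup>+x. ennreal ((1/2) powr p) * indicator A x \<partial>\<mu>)"
      using A(1) unfolding z_def by (subst ennreal_mult, simp, simp, subst nn_integral_cmult_indicator) simp_all
    also have "\<dots> \<le> (\<integral>\<^sup>+x. ennreal (\<bar>f x - a\<bar> powr p) \<partial>\<mu>)"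
    proof (rule nn_integral_mono_AE)
      show "AE x in \<mu>. ennreal ((1/2) powr p) * indicator A x \<le> ennreal (\<bar>f x - a\<bar> powr p)"
        using A(3)
      proof eventually_elim
        case (elim x)
        then show ?case
          using p by (cases "x \<in> A") (auto intro!: ennreal_leI powr_mono2)
      qed
    qed
    finally show ?thesis .
  qed
  have "z \<le> (INF a. \<integral>\<^sup>+x. ennreal (\<bar>f x - a\<bar> powr p) \<partial>\<mu>)"
  proof (rule INF_greatest)
    fix a :: real
    consider "1/2 \<le> \<bar>1 - a\<bar>" | "1/2 \<le> \<bar>a\<bar>" by linarith
    then show "z \<le> (\<integral>\<^sup>+x. ennreal (\<bar>f x - a\<bar> powr p) \<partial>\<mu>)"
    proof cases
      case 1
      then show ?thesis using AE half
        by (intro bound[of "{x. 0 < x \<bullet> e}"]) (auto elim!: eventually_mono)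
    next
      case 2
      then show ?thesis using AE other_half
        by (intro bound[of "{x. \<not> 0 < x \<bullet> e}"]) (auto elim!: eventually_mono)
    qed
  qed
  moreover have "0 < z" by (simp add: z_def)
  ultimately have "\<not> (INF a. \<integral>\<^sup>+x. ennreal (\<bar>f x - a\<bar> powr p) \<partial>\<mu>)
      \<le> C * (\<integral>\<^sup>+x. ennreal (norm (g x) powr p) \<partial>\<mu>)" for C
    unfolding zero by auto
  \<comment> \<open>Not even \<open>C = \<top>\<close> is admissible, because \<top> * 0 = 0; the
    constant is the infimum of the empty set.\<close>
  with fg have "{C. \<forall>f g. poincare_test f g \<longrightarrow>
      (INF a::real. \<integral>\<^sup>+x. ennreal (\<bar>f x - a\<bar> powr p) \<partial>\<mu>)
        \<le> C * (\<integral>\<^sup>+x. ennreal (norm (g x) powr p) \<partial>\<mu>)} = {}"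
    by blast
  then show ?thesis by (simp only: poincare_const_def Inf_empty)
qed

section \<open>Transport cost against entropy for a tilted density\<close>

definition tilt :: "real \<Rightarrow> 'a \<Rightarrow> real" where
  "tilt \<epsilon> x = (if 0 < x \<bullet> e then 1 + \<epsilon> else 1 - \<epsilon>)"

lemma measurable_tilt [measurable]: "tilt \<epsilon> \<in> borel_measurable borel"
  unfolding tilt_def by measurable

lemma expectation_two_values:
  fixes a b :: real
  shows
  "integrable \<mu> (\<lambda>x. if 0 < x \<bullet> e then a else b)"
  "(\<integral>x. (if 0 < x \<bullet> e then a else b) \<partial>\<mu>) = (a + b) / 2"
proof -
  have eq: "(\<lambda>x. if 0 < x \<bullet> e then a else b)
      = (\<lambda>x. a * indicator {x. 0 < x \<bullet> e} x + b * indicator {x. \<not> 0 < x \<bullet> e} x)"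
    by (auto simp: indicator_def)
  have "integrable \<mu> (indicator {x. 0 < x \<bullet> e} :: 'a \<Rightarrow> real)"
    "integrable \<mu> (indicator {x. \<not> 0 < x \<bullet> e} :: 'a \<Rightarrow> real)"
    by (auto intro!: integrable_real_indicator simp: emeasure_eq_measure)
  then show "integrable \<mu> (\<lambda>x. if 0 < x \<bullet> e then a else b)"
    "(\<integral>x. (if 0 < x \<bullet> e then a else b) \<partial>\<mu>) = (a + b) / 2"
    unfolding eq by (auto simp: half other_half add_divide_distrib)
qed

lemma prob_space_tilt:
  assumes "0 < \<epsilon>" "\<epsilon> < 1"
  shows "prob_space (density \<mu> (tilt \<epsilon>))"
proof (rule prob_spaceI)
  have "emeasure (density \<mu> (tilt \<epsilon>)) (space (density \<mu> (tilt \<epsilon>))) = (\<integral>\<^sup>+x. ennreal (tilt \<epsilon> x) \<partial>\<mu>)"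
    by (simp add: emeasure_density)
  also have "\<dots> = ennreal (\<integral>x. tilt \<epsilon> x \<partial>\<mu>)"
    unfolding tilt_def using assms expectation_two_values(1)[of "1 + \<epsilon>" "1 - \<epsilon>"]
    by (intro nn_integral_eq_integral) auto
  also have "\<dots> = 1" unfolding tilt_def expectation_two_values by simp
  finally show "emeasure (density \<mu> (tilt \<epsilon>)) (space (density \<mu> (tilt \<epsilon>))) = 1" .
qed

text \<open>After \<open>ln y \<le> y - 1\<close> the terms of first order cancel, because the two
  halves carry equal mass; \<epsilon>^2 remains.\<close>

lemma rel_entropy_tilt_le:
  assumes \<epsilon>: "0 < \<epsilon>" "\<epsilon> < 1"
  shows "rel_entropy (density \<mu> (tilt \<epsilon>)) \<mu> \<le> ennreal (\<epsilon>\<^sup>2)"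
proof -
  let ?\<nu> = "density \<mu> (tilt \<epsilon>)"
  have tilt0: "0 \<le> tilt \<epsilon> x" for x using \<epsilon> by (simp add: tilt_def)
  interpret N: prob_space ?\<nu> using \<epsilon> by (rule prob_space_tilt)
  have ac: "absolutely_continuous \<mu> ?\<nu>"
    by (rule absolutely_continuousI_density) simp
  have "density \<mu> (RN_deriv \<mu> ?\<nu>) = ?\<nu>"
    by (rule density_RN_deriv[OF ac]) simp
  then have "AE x in \<mu>. RN_deriv \<mu> ?\<nu> x = ennreal (tilt \<epsilon> x)"
    by (intro density_unique) auto
  then have RN: "AE x in ?\<nu>. RN_deriv \<mu> ?\<nu> x = ennreal (tilt \<epsilon> x)"
    using absolutely_continuous_AE[OF _ ac] by simp
  \<comment> \<open>The density takes only two values, so the logarithm is bounded.\<close>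
  have "integrable ?\<nu> (entropy_density (exp 1) \<mu> ?\<nu>)"
  proof (rule N.integrable_const_bound)
    show "AE x in ?\<nu>. norm (entropy_density (exp 1) \<mu> ?\<nu> x) \<le> \<bar>ln (1 + \<epsilon>)\<bar> + \<bar>ln (1 - \<epsilon>)\<bar>"
      using RN by eventually_elim (simp add: entropy_density_def tilt0, simp add: tilt_def log_def)
    show "entropy_density (exp 1) \<mu> ?\<nu> \<in> borel_measurable ?\<nu>"
      using measurable_entropy_density[of "exp 1" \<mu> ?\<nu>] by simp
  qed
  then have "rel_entropy ?\<nu> \<mu> = ennreal (KL_divergence (exp 1) \<mu> ?\<nu>)"
    using ac by (simp add: rel_entropy_def)
  also have "KL_divergence (exp 1) \<mu> ?\<nu> = (\<integral>x. tilt \<epsilon> x * log (exp 1) (tilt \<epsilon> x) \<partial>\<mu>)"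
    by (rule KL_density) (auto simp: tilt0)
  also have "\<dots> = (\<integral>x. (if 0 < x \<bullet> e then (1 + \<epsilon>) * ln (1 + \<epsilon>) else (1 - \<epsilon>) * ln (1 - \<epsilon>)) \<partial>\<mu>)"
    by (intro Bochner_Integration.integral_cong) (auto simp: tilt_def log_def)
  also have "\<dots> = ((1 + \<epsilon>) * ln (1 + \<epsilon>) + (1 - \<epsilon>) * ln (1 - \<epsilon>)) / 2"
    by (rule expectation_two_values)
  also have "\<dots> \<le> ((1 + \<epsilon>) * \<epsilon> + (1 - \<epsilon>) * (- \<epsilon>)) / 2"
    using \<epsilon> ln_le_minus_one[of "1 + \<epsilon>"] ln_le_minus_one[of "1 - \<epsilon>"]
    by (intro divide_right_mono add_mono mult_left_mono) auto
  also have "\<dots> = \<epsilon>\<^sup>2" by (simp add: algebra_simps power2_eq_square)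
  finally show ?thesis by (simp add: ennreal_leI)
qed

text \<open>The tilt adds mass \<epsilon>/2 to the upper side, so at least this much must cross the
  slab, over a distance of at least 2c: (2c)^2 \<epsilon>/2 is the stated bound.\<close>

lemma W2_squared_tilt_ge:
  assumes \<epsilon>: "0 < \<epsilon>" "\<epsilon> < 1"
  shows "ennreal (2 * c\<^sup>2 * \<epsilon>) \<le> W2_squared \<mu> (density \<mu> (tilt \<epsilon>))"
  unfolding W2_squared_def
proof (rule INF_greatest)
  let ?\<nu> = "density \<mu> (tilt \<epsilon>)"
  fix \<pi> assume "\<pi> \<in> Collect (coupling \<mu> ?\<nu>)"
  then have sets\<pi>[measurable_cong]: "sets \<pi> = sets borel"
    and m1: "distr \<pi> borel fst = \<mu>" and m2: "distr \<pi> borel snd = ?\<nu>"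
    by (auto simp: coupling_def)
  have [simp]: "space \<pi> = UNIV" using sets_eq_imp_space_eq[OF sets\<pi>] by simp
  have [measurable]: "fst \<in> \<pi> \<rightarrow>\<^sub>M (borel :: 'a measure)" "snd \<in> \<pi> \<rightarrow>\<^sub>M (borel :: 'a measure)"
    unfolding measurable_cong_sets[OF sets\<pi> refl]
    by (auto intro!: borel_measurable_continuous_onI continuous_intros)
  interpret N: prob_space ?\<nu> using \<epsilon> by (rule prob_space_tilt)
  interpret P: prob_space \<pi>
  proof (rule prob_spaceI)
    have "emeasure (distr \<pi> borel fst) UNIV = 1" unfolding m1 using emeasure_space_1 by simp
    then show "emeasure \<pi> (space \<pi>) = 1" by (subst (asm) emeasure_distr) auto
  qed
  let ?P = "{x. 0 < x \<bullet> e}"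
  let ?E = "{z. \<not> 0 < fst z \<bullet> e \<and> 0 < snd z \<bullet> e}"
  have E[measurable]: "?E \<in> sets \<pi>"
  proof -
    have "{z\<in>space \<pi>. \<not> 0 < fst z \<bullet> e \<and> 0 < snd z \<bullet> e} \<in> sets \<pi>" by measurable
    then show ?thesis by simp
  qed
  have "AE x in distr \<pi> borel fst. c \<le> \<bar>x \<bullet> e\<bar>" unfolding m1 by (rule gap)
  then have g1: "AE z in \<pi>. c \<le> \<bar>fst z \<bullet> e\<bar>" by (subst (asm) AE_distr_iff) auto
  have "AE x in ?\<nu>. c \<le> \<bar>x \<bullet> e\<bar>" using gap by (subst AE_density) auto
  then have "AE x in distr \<pi> borel snd. c \<le> \<bar>x \<bullet> e\<bar>" unfolding m2 .
  then have g2: "AE z in \<pi>. c \<le> \<bar>snd z \<bullet> e\<bar>" by (subst (asm) AE_distr_iff) auto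
  have n1: "P.prob {z. 0 < fst z \<bullet> e} = 1/2"
    using half unfolding m1[symmetric] by (subst (asm) measure_distr) (auto simp: vimage_def)
  have "emeasure \<mu> ?P = ennreal (1/2)" unfolding emeasure_eq_measure half ..
  then have P: "(\<integral>\<^sup>+x. ennreal (1 + \<epsilon>) * indicator ?P x \<partial>\<mu>) = ennreal (1 + \<epsilon>) * ennreal (1/2)"
    by (subst nn_integral_cmult_indicator) simp_all
  have "emeasure ?\<nu> ?P = (\<integral>\<^sup>+x. ennreal (1 + \<epsilon>) * indicator ?P x \<partial>\<mu>)"
    by (subst emeasure_density) (auto intro!: nn_integral_cong simp: tilt_def indicator_def)
  also have "\<dots> = ennreal ((1 + \<epsilon>) / 2)"
    unfolding P using \<epsilon> by (subst ennreal_mult[symmetric]) auto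
  finally have "measure ?\<nu> ?P = (1 + \<epsilon>) / 2" using \<epsilon> by (simp add: measure_def)
  then have n2: "P.prob {z. 0 < snd z \<bullet> e} = (1 + \<epsilon>) / 2"
    unfolding m2[symmetric] by (subst (asm) measure_distr) (auto simp: vimage_def)
  have "P.prob {z. 0 < snd z \<bullet> e} \<le> P.prob (?E \<union> {z\<in>space \<pi>. 0 < fst z \<bullet> e})"
    by (intro P.finite_measure_mono sets.Un E) auto
  also have "\<dots> \<le> P.prob ?E + P.prob {z\<in>space \<pi>. 0 < fst z \<bullet> e}"
    by (intro measure_Un_le E) measurable
  finally have PE: "\<epsilon> / 2 \<le> P.prob ?E" using n1 n2 by (simp add: field_simps)
  have "ennreal (2 * c\<^sup>2 * \<epsilon>) \<le> ennreal ((2 * c)\<^sup>2 * P.prob ?E)"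
    using mult_left_mono[OF PE, of "4 * c\<^sup>2"] by (intro ennreal_leI) (simp add: power_mult_distrib)
  also have "\<dots> = (\<integral>\<^sup>+z. ennreal ((2 * c)\<^sup>2) * indicator ?E z \<partial>\<pi>)"
    by (subst nn_integral_cmult_indicator) (auto simp: P.emeasure_eq_measure ennreal_mult)
  also have "\<dots> \<le> (\<integral>\<^sup>+z. ennreal ((norm (fst z - snd z))\<^sup>2) \<partial>\<pi>)"
  proof (rule nn_integral_mono_AE)
    show "AE z in \<pi>. ennreal ((2 * c)\<^sup>2) * indicator ?E z \<le> ennreal ((norm (fst z - snd z))\<^sup>2)"
      using g1 g2
    proof eventually_elim
      case (elim z)
      have "2 * c \<le> norm (fst z - snd z)" if "z \<in> ?E"
      proof -
        have "2 * c \<le> \<bar>(fst z - snd z) \<bullet> e\<bar>"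
          using that elim by (simp add: inner_diff_left)
        also have "\<dots> \<le> norm (fst z - snd z)"
          using Cauchy_Schwarz_ineq2[of "fst z - snd z" e] unit by simp
        finally show ?thesis .
      qed
      then show ?case
        using ennreal_leI[OF power_mono[of "2 * c" "norm (fst z - snd z)" 2]] pos
        by (cases "z \<in> ?E") (simp_all only: indicator_simps mult_1_right mult_zero_right zero_le, simp)
    qed
  qed
  also have "\<dots> = quadratic_cost \<pi>"
    by (simp add: quadratic_cost_def case_prod_unfold)
  finally show "ennreal (2 * c\<^sup>2 * \<epsilon>) \<le> quadratic_cost \<pi>" .
qed

lemma talagrand_const_eq_top: "talagrand_const \<mu> = \<top>"
proof -
  \<comment> \<open>In contrast to the Poincare constant, \<open>\<top>\<close> may be admissible
    here; what is excluded is every finite constant.\<close>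
  have "C = \<top>"
    if C: "\<forall>\<nu>. prob_space \<nu> \<and> sets \<nu> = sets borel \<longrightarrow> W2_squared \<mu> \<nu> \<le> C * rel_entropy \<nu> \<mu>" for C
  proof (rule ccontr)
    assume "C \<noteq> \<top>"
    then obtain K where K: "C = ennreal K" "K \<ge> 0" by (cases C) auto
    \<comment> \<open>The second bound makes K \<epsilon> at most c^2, against the 2 c^2 forced by
      the transport cost; K + 1 avoids division by 0, and 1/2 keeps the tilt positive.\<close>
    define \<epsilon> where "\<epsilon> = min (1/2) (c\<^sup>2 / (K + 1))"
    have \<epsilon>: "0 < \<epsilon>" "\<epsilon> < 1" "\<epsilon> \<le> c\<^sup>2 / (K + 1)"
      using K pos by (auto simp: \<epsilon>_def min_def)
    have "ennreal (2 * c\<^sup>2 * \<epsilon>) \<le> W2_squared \<mu> (density \<mu> (tilt \<epsilon>))"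
      using \<epsilon> by (intro W2_squared_tilt_ge)
    also have "\<dots> \<le> C * rel_entropy (density \<mu> (tilt \<epsilon>)) \<mu>"
      using C prob_space_tilt[OF \<epsilon>(1,2)] by simp
    also have "\<dots> \<le> ennreal K * ennreal (\<epsilon>\<^sup>2)"
      unfolding K(1) using \<epsilon> by (intro mult_left_mono rel_entropy_tilt_le) auto
    also have "\<dots> = ennreal (K * \<epsilon>\<^sup>2)" using K by (simp add: ennreal_mult)
    finally have "2 * c\<^sup>2 * \<epsilon> \<le> K * \<epsilon>\<^sup>2" using K by (subst (asm) ennreal_le_iff) auto
    then have "2 * c\<^sup>2 \<le> K * \<epsilon>" using \<epsilon>(1) by (simp add: power2_eq_square)
    also have "\<dots> \<le> (K + 1) * \<epsilon>" using \<epsilon>(1) by (simp add: algebra_simps)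
    also have "\<dots> \<le> c\<^sup>2" using \<epsilon>(3) K by (simp add: field_simps)
    finally show False using pos by simp
  qed
  then have "\<top> \<le> talagrand_const \<mu>"
    unfolding talagrand_const_def by (intro Inf_greatest) blast
  then show ?thesis by (simp add: top_unique)
qed

end

section \<open>The optimal coupling\<close>

text \<open>Reverses each half of [-1,1] separately: 1 - u for positive and -1 - u for negative
  \<open>u\<close>. On an arm of a V this exchanges vertex and tip, as the vertices of the two V's
  face opposite ways.\<close>

definition reflect :: "real \<Rightarrow> real" where
  "reflect u = sgn u - u"

lemma measurable_reflect [measurable]: "reflect \<in> borel_measurable borel"
  unfolding reflect_def[abs_def] sgn_real_def by measurable

lemma AE_unif: "AE u in unif. u \<in> {-1..1} \<and> u \<noteq> 0"
proof -
  have "AE u in lborel. u \<noteq> (0::real)" by (rule AE_lborel_singleton)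
  then show ?thesis unfolding unif_def by (intro AE_uniform_measureI) auto
qed

lemma distr_reflect_unif: "distr unif borel reflect = unif"
proof (rule measure_eqI)
  fix A assume "A \<in> sets (distr unif borel reflect)"
  then have [measurable]: "A \<in> sets borel" by simp
  define h where "h u = (indicator (A \<inter> {-1..1}) u * indicator {0<..} u :: ennreal)" for u :: real
  define k where "k u = (indicator (A \<inter> {-1..1}) u * indicator {..<0} u :: ennreal)" for u :: real
  have [measurable]: "h \<in> borel_measurable borel" "k \<in> borel_measurable borel"
    unfolding h_def k_def by measurable
  have ind: "emeasure unif B = (\<integral>\<^sup>+u. indicator ({-1..1} \<inter> B) u \<partial>lborel) / 2"
    if "B \<in> sets borel" for B using that by (simp add: emeasure_unif)
  have [measurable]: "reflect -` A \<in> sets borel"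
    using measurable_sets[of reflect borel borel A] by simp
  \<comment> \<open>\<open>h\<close> and \<open>k\<close> are the positive and the negative part of
    the set; each is carried back by its own affine substitution, and only 0, 1 and -1 need to be
    excluded as null points.\<close>
  have "(\<integral>\<^sup>+u. indicator ({-1..1} \<inter> (reflect -` A)) u \<partial>lborel)
      = (\<integral>\<^sup>+u. h (1 + (-1) * u) + k (-1 + (-1) * u) \<partial>lborel)"
    using AE_lborel_singleton[of 0] AE_lborel_singleton[of 1] AE_lborel_singleton[of "-1"]
    by (intro nn_integral_cong_AE, eventually_elim)
      (auto simp: reflect_def h_def k_def indicator_def sgn_real_def)
  also have "\<dots> = (\<integral>\<^sup>+u. h (1 + (-1) * u) \<partial>lborel) + (\<integral>\<^sup>+u. k (-1 + (-1) * u) \<partial>lborel)"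
    by (intro nn_integral_add) measurable
  also have "\<dots> = (\<integral>\<^sup>+u. h u \<partial>lborel) + (\<integral>\<^sup>+u. k u \<partial>lborel)"
    using nn_integral_real_affine[of h "-1" 1] nn_integral_real_affine[of k "-1" "-1"] by simp
  also have "\<dots> = (\<integral>\<^sup>+u. h u + k u \<partial>lborel)"
    by (intro nn_integral_add[symmetric]) measurable
  also have "\<dots> = (\<integral>\<^sup>+u. indicator ({-1..1} \<inter> A) u \<partial>lborel)"
    using AE_lborel_singleton[of 0]
    by (intro nn_integral_cong_AE, eventually_elim) (auto simp: h_def k_def indicator_def)
  finally have "emeasure unif (reflect -` A) = emeasure unif A" by (simp only: ind[OF \<open>reflect -` A \<in> sets borel\<close>] ind[OF \<open>A \<in> sets borel\<close>])
  then show "emeasure (distr unif borel reflect) A = emeasure unif A"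
    by (simp add: emeasure_distr)
qed simp

locale orthonormal_pair =
  fixes e1 e2 :: "'a::euclidean_space"
  assumes e1: "e1 \<bullet> e1 = 1" and e2: "e2 \<bullet> e2 = 1" and e12: "e1 \<bullet> e2 = 0"
begin

definition \<gamma>0 :: "real \<Rightarrow> 'a" where
  "\<gamma>0 = vee (- e1) (2 *\<^sub>R e1 + e2) (2 *\<^sub>R e1 - e2)"

definition \<gamma>1 :: "real \<Rightarrow> 'a" where
  "\<gamma>1 = vee e1 (- 2 *\<^sub>R e1 + e2) (- 2 *\<^sub>R e1 - e2)"

lemma \<gamma>0_eq: "\<gamma>0 u = (2 * \<bar>u\<bar> - 1) *\<^sub>R e1 + u *\<^sub>R e2"
  by (cases "0 \<le> u") (simp_all add: \<gamma>0_def vee_def algebra_simps)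

lemma \<gamma>1_eq: "\<gamma>1 u = (1 - 2 * \<bar>u\<bar>) *\<^sub>R e1 + u *\<^sub>R e2"
  by (cases "0 \<le> u") (simp_all add: \<gamma>1_def vee_def algebra_simps)

lemma measurable_\<gamma> [measurable]: "\<gamma>0 \<in> borel_measurable borel" "\<gamma>1 \<in> borel_measurable borel"
  by (simp_all add: \<gamma>0_def \<gamma>1_def)

lemma inner_simps_pair: "(a *\<^sub>R e1 + b *\<^sub>R e2) \<bullet> e1 = a" "(a *\<^sub>R e1 + b *\<^sub>R e2) \<bullet> e2 = b"
  using e1 e2 e12 inner_commute[of e2 e1] by (simp_all add: inner_add_left)

lemma pair_diff:
  "(a *\<^sub>R e1 + b *\<^sub>R e2) - (a' *\<^sub>R e1 + b' *\<^sub>R e2) = (a - a') *\<^sub>R e1 + (b - b') *\<^sub>R e2"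
  by (simp add: algebra_simps)

lemma pair_combination:
  "r *\<^sub>R (a *\<^sub>R e1 + b *\<^sub>R e2) + s *\<^sub>R (a' *\<^sub>R e1 + b' *\<^sub>R e2)
    = (r * a + s * a') *\<^sub>R e1 + (r * b + s * b') *\<^sub>R e2"
  by (simp add: algebra_simps)

lemma norm_pair: "(norm (a *\<^sub>R e1 + b *\<^sub>R e2))\<^sup>2 = a\<^sup>2 + b\<^sup>2"
  unfolding power2_norm_eq_inner using e1 e2 e12 inner_commute[of e2 e1]
  by (simp add: inner_add_left inner_add_right power2_eq_square)

text \<open>The lower bound of the cost turned into an identity. Besides the two potentials there
  are two nonnegative defects: the first vanishes exactly when the \<open>e1\<close>-coordinates
  agree, the second exactly when the points are not on opposite sides of the axis.\<close>

lemma cost_eq: "(norm (\<gamma>0 u - \<gamma>1 w))\<^sup>2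
   = ((2 * \<bar>u\<bar> - 1)\<^sup>2 + (1 - 2 * \<bar>w\<bar>)\<^sup>2) / 2 + 3 * (\<bar>u\<bar> + \<bar>w\<bar> - 1)\<^sup>2 + 2 * (\<bar>u\<bar> * \<bar>w\<bar> - u * w)"
proof -
  have "\<gamma>0 u - \<gamma>1 w = ((2 * \<bar>u\<bar> - 1) - (1 - 2 * \<bar>w\<bar>)) *\<^sub>R e1 + (u - w) *\<^sub>R e2"
    unfolding \<gamma>0_eq \<gamma>1_eq by (rule pair_diff)
  then have "(norm (\<gamma>0 u - \<gamma>1 w))\<^sup>2 = ((2 * \<bar>u\<bar> - 1) - (1 - 2 * \<bar>w\<bar>))\<^sup>2 + (u - w)\<^sup>2"
    by (simp only: norm_pair)
  also have "(u - w)\<^sup>2 = \<bar>u\<bar>\<^sup>2 - 2 * (u * w) + \<bar>w\<bar>\<^sup>2" by (simp add: power2_diff)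
  also have "((2 * a - 1) - (1 - 2 * b))\<^sup>2 + (a\<^sup>2 - 2 * q + b\<^sup>2)
      = ((2 * a - 1)\<^sup>2 + (1 - 2 * b)\<^sup>2) / 2 + 3 * (a + b - 1)\<^sup>2 + 2 * (a * b - q)" for a b q :: real
    by (simp add: power2_eq_square field_simps)
  finally show ?thesis .
qed

text \<open>Used as dual potential on both marginals.\<close>

definition pot :: "'a \<Rightarrow> real" where
  "pot x = (x \<bullet> e1)\<^sup>2 / 2"

lemma measurable_pot [measurable]: "pot \<in> borel_measurable borel"
  unfolding pot_def by measurable

lemma pot_\<gamma>: "pot (\<gamma>0 u) = (2 * \<bar>u\<bar> - 1)\<^sup>2 / 2" "pot (\<gamma>1 u) = (1 - 2 * \<bar>u\<bar>)\<^sup>2 / 2"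
  by (simp_all add: pot_def \<gamma>0_eq \<gamma>1_eq inner_simps_pair)

lemma pot_nonneg: "0 \<le> pot x" by (simp add: pot_def)

lemma pot_le_cost: "pot (\<gamma>0 u) + pot (\<gamma>1 w) \<le> (norm (\<gamma>0 u - \<gamma>1 w))\<^sup>2"
  unfolding cost_eq pot_\<gamma> using abs_ge_self[of "u * w"] by (simp add: abs_mult add_divide_distrib)

text \<open>Both defects of \<open>cost_eq\<close> must vanish, which fixes the size and the sign of
  \<open>w\<close>. The vertex is excluded because for \<open>u = 0\<close> both w = 1 and w = -1
  attain equality.\<close>

lemma cost_le_pot:
  assumes "(norm (\<gamma>0 u - \<gamma>1 w))\<^sup>2 \<le> pot (\<gamma>0 u) + pot (\<gamma>1 w)" "u \<noteq> 0"
  shows "w = reflect u"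
proof -
  have "3 * (\<bar>u\<bar> + \<bar>w\<bar> - 1)\<^sup>2 + 2 * (\<bar>u\<bar> * \<bar>w\<bar> - u * w) \<le> 0"
    using assms(1) unfolding cost_eq pot_\<gamma> by (simp add: add_divide_distrib)
  moreover have "0 \<le> \<bar>u\<bar> * \<bar>w\<bar> - u * w"
    using abs_ge_self[of "u * w"] by (simp add: abs_mult)
  moreover have "0 \<le> (\<bar>u\<bar> + \<bar>w\<bar> - 1)\<^sup>2" by simp
  ultimately have "(\<bar>u\<bar> + \<bar>w\<bar> - 1)\<^sup>2 = 0 \<and> \<bar>u\<bar> * \<bar>w\<bar> - u * w = 0"
    by argo
  then have 1: "(\<bar>u\<bar> + \<bar>w\<bar> - 1)\<^sup>2 \<le> 0" and 2: "\<bar>u\<bar> * \<bar>w\<bar> = u * w" by auto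
  from 1 have "\<bar>w\<bar> = 1 - \<bar>u\<bar>" by simp
  moreover have "0 \<le> u * w" unfolding 2[symmetric] by simp
  ultimately show ?thesis using \<open>u \<noteq> 0\<close>
    by (auto simp: reflect_def sgn_real_def zero_le_mult_iff abs_if split: if_splits)
qed

lemma cost_reflect:
  assumes "u \<in> {-1..1}" "u \<noteq> 0"
  shows "(norm (\<gamma>0 u - \<gamma>1 (reflect u)))\<^sup>2 = pot (\<gamma>0 u) + pot (\<gamma>1 (reflect u))"
proof -
  have "\<bar>reflect u\<bar> = 1 - \<bar>u\<bar>" "u * reflect u = \<bar>u\<bar> * (1 - \<bar>u\<bar>)"
    using assms by (auto simp: reflect_def sgn_real_def abs_if algebra_simps)
  then show ?thesis unfolding cost_eq pot_\<gamma> by (simp add: add_divide_distrib)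
qed

section \<open>Duality and uniqueness for the two measures\<close>

definition \<mu>0 :: "'a measure" where "\<mu>0 = distr unif borel \<gamma>0"
definition \<mu>1 :: "'a measure" where "\<mu>1 = distr unif borel \<gamma>1"
text \<open>
  \<open>\<gamma>0 u\<close> and \<open>\<gamma>1 (reflect u)\<close> have the same \<open>e1\<close>-coordinate: this is the coupling by the shift
  along \<open>e2\<close> within each branch.
\<close>

definition \<pi>0 :: "('a \<times> 'a) measure" where
  "\<pi>0 = distr unif borel (\<lambda>u. (\<gamma>0 u, \<gamma>1 (reflect u)))"

lemma measurable_pair_\<gamma> [measurable]: "(\<lambda>u. (\<gamma>0 u, \<gamma>1 (reflect u))) \<in> borel_measurable borel"
  by (intro borel_measurable_Pair) measurable

lemma measurable_fst_snd [measurable]: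
  "fst \<in> borel_measurable (borel :: ('a \<times> 'a) measure)"
  "snd \<in> borel_measurable (borel :: ('a \<times> 'a) measure)"
  by (auto intro!: borel_measurable_continuous_onI continuous_intros)

lemma coupling_\<pi>0: "coupling \<mu>0 \<mu>1 \<pi>0"
proof -
  have "distr unif borel (\<lambda>u. \<gamma>1 (reflect u)) = distr (distr unif borel reflect) borel \<gamma>1"
    by (subst distr_distr) (auto simp: comp_def)
  then have "distr unif borel (\<lambda>u. \<gamma>1 (reflect u)) = \<mu>1"
    by (simp add: distr_reflect_unif \<mu>1_def)
  then show ?thesis
    using coupling_distr[of \<gamma>0 unif "\<lambda>u. \<gamma>1 (reflect u)"] by (simp add: \<mu>0_def \<pi>0_def)
qed

lemma AE_\<mu>0: "AE x in \<mu>0. x = \<gamma>0 (x \<bullet> e2) \<and> x \<bullet> e2 \<noteq> 0"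
proof -
  have "AE u in unif. \<gamma>0 u = \<gamma>0 (\<gamma>0 u \<bullet> e2) \<and> \<gamma>0 u \<bullet> e2 \<noteq> 0"
    using AE_unif by eventually_elim (simp add: \<gamma>0_eq inner_simps_pair)
  then show ?thesis unfolding \<mu>0_def by (subst AE_distr_iff) auto
qed

lemma AE_\<mu>1: "AE y in \<mu>1. y = \<gamma>1 (y \<bullet> e2)"
proof -
  have "AE u in unif. \<gamma>1 u = \<gamma>1 (\<gamma>1 u \<bullet> e2)"
    by (simp add: \<gamma>1_eq inner_simps_pair)
  then show ?thesis unfolding \<mu>1_def by (subst AE_distr_iff) auto
qed

text \<open>The parameter of a point on either curve is its \<open>e2\<close>-coordinate. Under an
  arbitrary coupling both parameters can thus be read off almost everywhere, and the pointwise
  inequalities in \<open>u\<close> and \<open>w\<close> apply.\<close>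

lemma coupling_AE_marginals:
  assumes \<pi>: "coupling \<mu>0 \<mu>1 \<pi>"
  shows "AE z in \<pi>. fst z = \<gamma>0 (fst z \<bullet> e2) \<and> fst z \<bullet> e2 \<noteq> 0 \<and> snd z = \<gamma>1 (snd z \<bullet> e2)"
proof -
  have [measurable_cong]: "sets \<pi> = sets borel"
    and m: "distr \<pi> borel fst = \<mu>0" "distr \<pi> borel snd = \<mu>1"
    using \<pi> by (auto simp: coupling_def)
  have "AE x in distr \<pi> borel fst. x = \<gamma>0 (x \<bullet> e2) \<and> x \<bullet> e2 \<noteq> 0" unfolding m by (rule AE_\<mu>0)
  then have "AE z in \<pi>. fst z = \<gamma>0 (fst z \<bullet> e2) \<and> fst z \<bullet> e2 \<noteq> 0"
    by (subst (asm) AE_distr_iff) auto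
  moreover have "AE y in distr \<pi> borel snd. y = \<gamma>1 (y \<bullet> e2)" unfolding m by (rule AE_\<mu>1)
  then have "AE z in \<pi>. snd z = \<gamma>1 (snd z \<bullet> e2)"
    by (subst (asm) AE_distr_iff) auto
  ultimately show ?thesis by eventually_elim auto
qed

definition dual_value :: ennreal where
  "dual_value = (\<integral>\<^sup>+x. ennreal (pot x) \<partial>\<mu>0) + (\<integral>\<^sup>+y. ennreal (pot y) \<partial>\<mu>1)"

text \<open>Needed for uniqueness: equal integrals of ordered functions force equality almost
  everywhere only if they are finite.\<close>

lemma dual_value_finite: "dual_value < \<top>"
proof -
  interpret U: prob_space unif by (rule prob_space_unif)
  have "(\<integral>\<^sup>+u. ennreal (pot (\<gamma> u)) \<partial>unif) \<le> (\<integral>\<^sup>+u. 1 \<partial>unif)"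
    if "\<gamma> = \<gamma>0 \<or> \<gamma> = \<gamma>1" for \<gamma>
  proof (rule nn_integral_mono_AE)
    show "AE u in unif. ennreal (pot (\<gamma> u)) \<le> 1"
      using AE_unif
    proof eventually_elim
      case (elim u)
      then have "\<bar>2 * \<bar>u\<bar> - 1\<bar> \<le> 1" "\<bar>1 - 2 * \<bar>u\<bar>\<bar> \<le> 1" by auto
      then have "(2 * \<bar>u\<bar> - 1)\<^sup>2 \<le> 1" "(1 - 2 * \<bar>u\<bar>)\<^sup>2 \<le> 1" by (simp_all only: abs_square_le_1)
      then have "pot (\<gamma> u) \<le> 1" using that by (auto simp: pot_\<gamma>)
      then show ?case by (simp add: ennreal_le_1)
    qed
  qed
  from this[of \<gamma>0] this[of \<gamma>1] have
    "(\<integral>\<^sup>+u. ennreal (pot (\<gamma>0 u)) \<partial>unif) < \<top>" "(\<integral>\<^sup>+u. ennreal (pot (\<gamma>1 u)) \<partial>unif) < \<top>"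
    using U.emeasure_space_1 by (auto intro: le_less_trans[OF _ ennreal_one_less_top])
  then show ?thesis
    unfolding dual_value_def \<mu>0_def \<mu>1_def by (subst (1 2) nn_integral_distr) auto
qed

lemma measurable_cost [measurable]:
  "(\<lambda>z. ennreal ((norm (fst z - snd z))\<^sup>2)) \<in> borel_measurable (borel :: ('a \<times> 'a) measure)"
  by (intro measurable_compose[OF _ measurable_ennreal] borel_measurable_continuous_onI continuous_intros)

lemma nn_integral_pot:
  assumes \<pi>: "coupling \<mu>0 \<mu>1 \<pi>"
  shows "(\<integral>\<^sup>+z. ennreal (pot (fst z) + pot (snd z)) \<partial>\<pi>) = dual_value"
proof -
  have [measurable_cong]: "sets \<pi> = sets borel"
    and m: "distr \<pi> borel fst = \<mu>0" "distr \<pi> borel snd = \<mu>1"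
    using \<pi> by (auto simp: coupling_def)
  have "(\<integral>\<^sup>+z. ennreal (pot (fst z) + pot (snd z)) \<partial>\<pi>)
      = (\<integral>\<^sup>+z. ennreal (pot (fst z)) + ennreal (pot (snd z)) \<partial>\<pi>)"
    by (simp add: pot_nonneg)
  also have "\<dots> = (\<integral>\<^sup>+z. ennreal (pot (fst z)) \<partial>\<pi>) + (\<integral>\<^sup>+z. ennreal (pot (snd z)) \<partial>\<pi>)"
    by (intro nn_integral_add) measurable
  also have "(\<integral>\<^sup>+z. ennreal (pot (fst z)) \<partial>\<pi>) = (\<integral>\<^sup>+x. ennreal (pot x) \<partial>\<mu>0)"
    unfolding m[symmetric] by (subst nn_integral_distr) auto
  also have "(\<integral>\<^sup>+z. ennreal (pot (snd z)) \<partial>\<pi>) = (\<integral>\<^sup>+y. ennreal (pot y) \<partial>\<mu>1)"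
    unfolding m[symmetric] by (subst nn_integral_distr) auto
  finally show ?thesis by (simp add: dual_value_def)
qed

lemma quadratic_cost_alt:
  "quadratic_cost \<pi> = (\<integral>\<^sup>+z. ennreal ((norm (fst z - snd z))\<^sup>2) \<partial>\<pi>)" for \<pi> :: "('a \<times> 'a) measure"
  by (simp add: quadratic_cost_def case_prod_unfold)

lemma AE_pot_le_cost:
  assumes \<pi>: "coupling \<mu>0 \<mu>1 \<pi>"
  shows "AE z in \<pi>. ennreal (pot (fst z) + pot (snd z)) \<le> ennreal ((norm (fst z - snd z))\<^sup>2)"
  using coupling_AE_marginals[OF \<pi>]
proof eventually_elim
  case (elim z)
  then show ?case
    using pot_le_cost[of "fst z \<bullet> e2" "snd z \<bullet> e2"] by (intro ennreal_leI) metis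
qed

lemma dual_value_le_cost:
  assumes \<pi>: "coupling \<mu>0 \<mu>1 \<pi>"
  shows "dual_value \<le> quadratic_cost \<pi>"
  unfolding nn_integral_pot[OF \<pi>, symmetric] quadratic_cost_alt
  by (intro nn_integral_mono_AE AE_pot_le_cost \<pi>)

lemma quadratic_cost_\<pi>0: "quadratic_cost \<pi>0 = dual_value"
proof -
  have "quadratic_cost \<pi>0 = (\<integral>\<^sup>+u. ennreal ((norm (\<gamma>0 u - \<gamma>1 (reflect u)))\<^sup>2) \<partial>unif)"
    unfolding quadratic_cost_alt \<pi>0_def by (subst nn_integral_distr) auto
  also have "\<dots> = (\<integral>\<^sup>+u. ennreal (pot (\<gamma>0 u) + pot (\<gamma>1 (reflect u))) \<partial>unif)"
    by (intro nn_integral_cong_AE eventually_mono[OF AE_unif]) (auto simp: cost_reflect)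
  also have "\<dots> = (\<integral>\<^sup>+z. ennreal (pot (fst z) + pot (snd z)) \<partial>\<pi>0)"
    unfolding \<pi>0_def by (subst nn_integral_distr) auto
  also have "\<dots> = dual_value" by (rule nn_integral_pot[OF coupling_\<pi>0])
  finally show ?thesis .
qed

text \<open>For a minimiser the cost and the sum of the potentials have the same finite integral, so
  they agree almost everywhere. The equality case then makes the second component a function
  \<open>T\<close> of the first, and a coupling concentrated on a graph is determined by its first
  marginal.\<close>

lemma optimal_coupling_iff: "optimal_coupling \<mu>0 \<mu>1 \<pi> \<longleftrightarrow> \<pi> = \<pi>0"
proof
  assume "\<pi> = \<pi>0"
  then show "optimal_coupling \<mu>0 \<mu>1 \<pi>"
    by (simp add: optimal_coupling_def coupling_\<pi>0 quadratic_cost_\<pi>0 dual_value_le_cost)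
next
  assume opt: "optimal_coupling \<mu>0 \<mu>1 \<pi>"
  then have \<pi>: "coupling \<mu>0 \<mu>1 \<pi>" and "quadratic_cost \<pi> \<le> dual_value"
    using coupling_\<pi>0 quadratic_cost_\<pi>0 by (auto simp: optimal_coupling_def)
  have sets\<pi>[measurable_cong]: "sets \<pi> = sets borel" and m: "distr \<pi> borel fst = \<mu>0"
    using \<pi> by (auto simp: coupling_def)
  let ?p = "\<lambda>z. ennreal (pot (fst z) + pot (snd z))" and ?c = "\<lambda>z. ennreal ((norm (fst z - snd z))\<^sup>2)"
  have "AE z in \<pi>. ?c z \<le> ?p z"
  proof (rule ccontr)
    assume "\<not> (AE z in \<pi>. ?c z \<le> ?p z)"
    then have "(\<integral>\<^sup>+z. ?p z \<partial>\<pi>) < (\<integral>\<^sup>+z. ?c z \<partial>\<pi>)"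
      using dual_value_finite AE_pot_le_cost[OF \<pi>]
      by (intro nn_integral_less) (auto simp: nn_integral_pot[OF \<pi>])
    with \<open>quadratic_cost \<pi> \<le> dual_value\<close> show False
      by (simp add: nn_integral_pot[OF \<pi>] quadratic_cost_alt)
  qed
  define T where "T x = \<gamma>1 (reflect (x \<bullet> e2))" for x
  have [measurable]: "T \<in> borel_measurable borel" unfolding T_def by measurable
  have mT[measurable]: "(\<lambda>x. (x, T x)) \<in> borel_measurable borel"
    by (intro borel_measurable_Pair) measurable
  have "AE z in \<pi>. z = (fst z, T (fst z))"
    using \<open>AE z in \<pi>. ?c z \<le> ?p z\<close> coupling_AE_marginals[OF \<pi>]
  proof eventually_elim
    case (elim z)
    then have "(norm (fst z - snd z))\<^sup>2 \<le> pot (fst z) + pot (snd z)"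
      by (subst (asm) ennreal_le_iff) (auto simp: pot_nonneg)
    then have "snd z \<bullet> e2 = reflect (fst z \<bullet> e2)"
      using elim cost_le_pot[of "fst z \<bullet> e2" "snd z \<bullet> e2"] by metis
    then have "snd z = T (fst z)" using elim by (simp add: T_def)
    then show ?case by (metis prod.collapse)
  qed
  then have "distr \<pi> borel (\<lambda>z. z) = distr \<pi> borel (\<lambda>z. (fst z, T (fst z)))"
    by (intro distr_cong_AE) (auto intro!: measurable_compose[OF _ mT] simp: measurable_cong_sets[OF sets\<pi> refl])
  moreover have "distr \<pi> borel (\<lambda>z. z) = \<pi>"
    using sets\<pi>[symmetric] by (rule distr_id2)
  ultimately have "\<pi> = distr \<pi> borel (\<lambda>z. (fst z, T (fst z)))" by simp
  also have "\<dots> = distr (distr \<pi> borel fst) borel (\<lambda>x. (x, T x))"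
    by (subst distr_distr) (auto simp: comp_def)
  also have "\<dots> = distr unif borel (\<lambda>u. (\<gamma>0 u, T (\<gamma>0 u)))"
    unfolding m \<mu>0_def by (subst distr_distr) (auto simp: comp_def)
  also have "\<dots> = \<pi>0"
    unfolding \<pi>0_def T_def by (simp add: \<gamma>0_eq inner_simps_pair)
  finally show "\<pi> = \<pi>0" .
qed

text \<open>The \<open>e1\<close>-coordinate does not move, and the height of the upper branch is
  the average of t and 1 - t with weights 1 - \<bar>u\<bar> and \<bar>u\<bar>. It thus runs from t
  to 1 - t, as on \<open>Gamma_plus t\<close>, and never falls below the smaller of the two.\<close>

lemma interpolation_disconnected:
  assumes t: "0 < t" "t < 1"
  shows "disconnected_measure (distr \<pi>0 borel (\<lambda>(x, y). (1 - t) *\<^sub>R x + t *\<^sub>R y)) e2 (min t (1 - t))"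
proof -
  interpret U: prob_space unif by (rule prob_space_unif)
  define \<gamma> where "\<gamma> u = (1 - t) *\<^sub>R \<gamma>0 u + t *\<^sub>R \<gamma>1 (reflect u)" for u
  have [measurable]: "\<gamma> \<in> borel_measurable borel" unfolding \<gamma>_def by measurable
  have [measurable]: "(\<lambda>(x, y). (1 - t) *\<^sub>R x + t *\<^sub>R y) \<in> borel_measurable (borel :: ('a \<times> 'a) measure)"
    unfolding case_prod_unfold by (intro borel_measurable_continuous_onI continuous_intros)
  have eq: "distr \<pi>0 borel (\<lambda>(x, y). (1 - t) *\<^sub>R x + t *\<^sub>R y) = distr unif borel \<gamma>"
    unfolding \<pi>0_def by (subst distr_distr) (auto simp: comp_def \<gamma>_def[abs_def])
  define s where "s u = sgn u * (t + (1 - 2 * t) * \<bar>u\<bar>)" for u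
  have \<gamma>: "\<gamma> u = (2 * \<bar>u\<bar> - 1) *\<^sub>R e1 + s u *\<^sub>R e2" if "u \<in> {-1..1}" "u \<noteq> 0" for u
  proof -
    have r: "\<bar>reflect u\<bar> = 1 - \<bar>u\<bar>" using that by (auto simp: reflect_def sgn_real_def abs_if)
    have "(1 - t) * (2 * \<bar>u\<bar> - 1) + t * (1 - 2 * \<bar>reflect u\<bar>) = 2 * \<bar>u\<bar> - 1"
      unfolding r by (simp add: algebra_simps)
    then have "\<gamma> u = (2 * \<bar>u\<bar> - 1) *\<^sub>R e1 + ((1 - t) * u + t * reflect u) *\<^sub>R e2"
      unfolding \<gamma>_def \<gamma>0_eq \<gamma>1_eq pair_combination by simp
    also have "(1 - t) * u + t * reflect u = s u"
      using that by (auto simp: reflect_def s_def sgn_real_def algebra_simps)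
    finally show ?thesis .
  qed
  have s_bound: "min t (1 - t) \<le> t + (1 - 2 * t) * \<bar>u\<bar> \<and> t + (1 - 2 * t) * \<bar>u\<bar> \<le> 1"
    if "u \<in> {-1..1}" for u
  proof -
    have "t + (1 - 2 * t) * \<bar>u\<bar> = (1 - \<bar>u\<bar>) * t + \<bar>u\<bar> * (1 - t)" by (simp add: algebra_simps)
    moreover have "(1 - \<bar>u\<bar>) * t + \<bar>u\<bar> * (1 - t) \<ge> (1 - \<bar>u\<bar>) * min t (1 - t) + \<bar>u\<bar> * min t (1 - t)"
      using that by (intro add_mono mult_left_mono) auto
    moreover have "(1 - \<bar>u\<bar>) * t + \<bar>u\<bar> * (1 - t) \<le> (1 - \<bar>u\<bar>) * 1 + \<bar>u\<bar> * 1"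
      using that t by (intro add_mono mult_left_mono) auto
    ultimately show ?thesis by (simp add: algebra_simps)
  qed
  have c: "0 < min t (1 - t)" using t by simp
  have props: "AE u in unif. (norm (\<gamma> u))\<^sup>2 \<le> 2 \<and> min t (1 - t) \<le> \<bar>\<gamma> u \<bullet> e2\<bar> \<and> (0 < \<gamma> u \<bullet> e2 \<longleftrightarrow> 0 < u)"
    using AE_unif
  proof eventually_elim
    case (elim u)
    have s_pos: "0 < t + (1 - 2 * t) * \<bar>u\<bar>"
      using s_bound[of u] elim by (intro less_le_trans[OF c]) simp
    then have abs: "\<bar>s u\<bar> = t + (1 - 2 * t) * \<bar>u\<bar>"
      using elim by (simp add: s_def abs_mult abs_sgn_eq)
    have "(2 * \<bar>u\<bar> - 1)\<^sup>2 \<le> 1"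
      using elim by (subst abs_square_le_1) auto
    moreover have "(s u)\<^sup>2 \<le> 1"
      using s_bound[of u] elim abs by (subst abs_square_le_1) auto
    ultimately have "(norm (\<gamma> u))\<^sup>2 \<le> 2" using elim by (simp add: \<gamma> norm_pair)
    moreover have "0 < s u \<longleftrightarrow> 0 < u"
      using s_pos unfolding s_def by (auto simp: zero_less_mult_iff)
    ultimately show ?case using elim abs s_bound[of u] by (simp add: \<gamma> inner_simps_pair)
  qed
  interpret M: prob_space "distr unif borel \<gamma>" by (rule U.prob_space_distr) simp
  have "emeasure unif {0<..} = ennreal (1/2)"
  proof -
    have "{-1..1} \<inter> {0<..} = {0<..1::real}" by auto
    then show ?thesis using divide_ennreal[of 1 2] by (simp add: emeasure_unif)
  qed
  moreover have "emeasure unif {u. 0 < \<gamma> u \<bullet> e2} = emeasure unif {0<..}"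
    using props by (intro emeasure_eq_AE) (auto elim!: eventually_mono)
  ultimately have "measure unif {u. 0 < \<gamma> u \<bullet> e2} = 1/2"
    by (intro measure_eq_emeasure_eq_ennreal) (simp, simp only:)
  then have half: "M.prob {x. 0 < x \<bullet> e2} = 1/2"
    by (subst measure_distr) (auto simp: vimage_def)
  show ?thesis
    unfolding eq
  proof unfold_locales
    show "norm e2 = 1" using e2 by (simp add: norm_eq_sqrt_inner)
    show "AE x in distr unif borel \<gamma>. (norm x)\<^sup>2 \<le> 2"
      using props by (subst AE_distr_iff) (auto elim!: eventually_mono)
    show "AE x in distr unif borel \<gamma>. min t (1 - t) \<le> \<bar>x \<bullet> e2\<bar>"
      using props by (subst AE_distr_iff) (auto elim!: eventually_mono)
  qed (use c half in auto)
qed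

lemma propagation_fails:
  assumes p: "1 \<le> p" and \<mu>: "displacement_interpolation \<mu>0 \<mu>1 \<mu>"
  shows "poincare_const p \<mu>0 < \<top>" "talagrand_const \<mu>0 < \<top>"
    "poincare_const p \<mu>1 < \<top>" "talagrand_const \<mu>1 < \<top>"
    "0 < t \<Longrightarrow> t < 1 \<Longrightarrow> poincare_const p (\<mu> t) = \<top> \<and> talagrand_const (\<mu> t) = \<top>"
proof -
  show "poincare_const p \<mu>0 < \<top>" "poincare_const p \<mu>1 < \<top>"
    unfolding \<mu>0_def \<mu>1_def \<gamma>0_def \<gamma>1_def by (rule poincare_const_vee_finite[OF p])+
  show "talagrand_const \<mu>0 < \<top>" "talagrand_const \<mu>1 < \<top>"
    unfolding \<mu>0_def \<mu>1_def \<gamma>0_def \<gamma>1_def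
    by (rule talagrand_const_lipschitz_curve_finite[OF measurable_vee lipschitz_on_vee])+
  assume t: "0 < t" "t < 1"
  have "\<mu> t = distr \<pi>0 borel (\<lambda>(x, y). (1 - t) *\<^sub>R x + t *\<^sub>R y)"
    using \<mu> t by (auto simp: displacement_interpolation_def optimal_coupling_iff)
  then interpret disconnected_measure "\<mu> t" e2 "min t (1 - t)"
    using interpolation_disconnected[OF t] by simp
  show "poincare_const p (\<mu> t) = \<top> \<and> talagrand_const (\<mu> t) = \<top>"
    using poincare_const_eq_top[OF p] talagrand_const_eq_top by simp
qed

lemma displacement_interpolation_exists: "\<exists>\<mu>. displacement_interpolation \<mu>0 \<mu>1 \<mu>"
  unfolding displacement_interpolation_def
  by (intro exI[of _ "\<lambda>t. distr \<pi>0 borel (\<lambda>(x, y). (1 - t) *\<^sub>R x + t *\<^sub>R y)"] exI[of _ \<pi>0])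
    (simp add: optimal_coupling_iff)

lemma prob_space_\<mu>: "prob_space \<mu>0" "prob_space \<mu>1" "sets \<mu>0 = sets borel" "sets \<mu>1 = sets borel"
  unfolding \<mu>0_def \<mu>1_def by (auto intro!: prob_space.prob_space_distr prob_space_unif)

section \<open>Identification with the arclength measures\<close>

lemma segments_meet_at_vertex:
  assumes "d \<bullet> e2 = 1" "d' \<bullet> e2 = -1"
  shows "closed_segment v (v + d) \<inter> closed_segment v (v + d') = {v}"
proof
  show "closed_segment v (v + d) \<inter> closed_segment v (v + d') \<subseteq> {v}"
  proof
    \<comment> \<open>The \<open>e2\<close>-coordinate increases along one arm and decreases along
      the other, so a common point has parameter 0 on both.\<close>
    have seg: "\<exists>s\<ge>0. x = v + s *\<^sub>R d" if "x \<in> closed_segment v (v + d)" for x d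
      using that by (auto simp: closed_segment_def algebra_simps)
    fix x assume "x \<in> closed_segment v (v + d) \<inter> closed_segment v (v + d')"
    then obtain s r where s: "0 \<le> s" "x = v + s *\<^sub>R d" and r: "0 \<le> r" "x = v + r *\<^sub>R d'"
      using seg by blast
    have "x \<bullet> e2 = v \<bullet> e2 + s" unfolding s(2) using assms by (simp add: inner_add_left)
    moreover have "x \<bullet> e2 = v \<bullet> e2 - r" unfolding r(2) using assms by (simp add: inner_add_left)
    ultimately have "s = 0" using s(1) r(1) by linarith
    then show "x \<in> {v}" using s by simp
  qed
qed simp

lemma arclength_measure_eq:
  "arclength_measure (closed_segment (- e1) (e1 + e2) \<union> closed_segment (- e1) (e1 - e2)) = \<mu>0"
  "arclength_measure (closed_segment (- e1 + e2) e1 \<union> closed_segment (- e1 - e2) e1) = \<mu>1"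
proof -
  \<comment> \<open>Treats both V's at once: r = 1 has its vertex at -e1 and opens towards e1, r =
    -1 is its mirror image.\<close>
  have main: "arclength_measure (closed_segment (- (r *\<^sub>R e1)) (r *\<^sub>R e1 + e2) \<union> closed_segment (- (r *\<^sub>R e1)) (r *\<^sub>R e1 - e2))
      = distr unif borel (vee (- (r *\<^sub>R e1)) ((2 * r) *\<^sub>R e1 + e2) ((2 * r) *\<^sub>R e1 - e2))" for r
  proof -
    let ?v = "- (r *\<^sub>R e1)" and ?d = "(2 * r) *\<^sub>R e1 + e2" and ?d' = "(2 * r) *\<^sub>R e1 - e2"
    have e: "?d \<bullet> e2 = 1" "?d' \<bullet> e2 = -1"
      using inner_simps_pair(2)[of "2 * r" 1] inner_simps_pair(2)[of "2 * r" "-1"] by simp_all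
    have "(norm ?d)\<^sup>2 = (norm ?d')\<^sup>2"
      using norm_pair[of "2 * r" 1] norm_pair[of "2 * r" "-1"] by simp
    then have "norm ?d = norm ?d'" by (rule power2_eq_imp_eq) simp_all
    moreover have "?d \<noteq> 0" using e(1) by (metis inner_zero_left zero_neq_one)
    ultimately have "arclength_measure (closed_segment ?v (?v + ?d) \<union> closed_segment ?v (?v + ?d'))
      = distr unif borel (vee ?v ?d ?d')"
      by (rule arclength_measure_two_segments) (rule segments_meet_at_vertex[OF e])
    moreover have "?v + ?d = r *\<^sub>R e1 + e2" "?v + ?d' = r *\<^sub>R e1 - e2"
      unfolding mult_2 scaleR_left_distrib by simp_all
    ultimately show ?thesis by (simp only:)
  qed
  show "arclength_measure (closed_segment (- e1) (e1 + e2) \<union> closed_segment (- e1) (e1 - e2)) = \<mu>0"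
    using main[of 1] by (simp add: \<mu>0_def \<gamma>0_def)
  show "arclength_measure (closed_segment (- e1 + e2) e1 \<union> closed_segment (- e1 - e2) e1) = \<mu>1"
    using main[of "-1"] by (simp add: \<mu>1_def \<gamma>1_def closed_segment_commute)
qed

end

text \<open>The first conjunct gives sense to speaking of the displacement interpolation, and its
  existence part keeps the second one from being vacuous.\<close>

theorem corollary5p2:
  fixes p :: real and \<mu>0 \<mu>1 :: "(real^2) measure"
  assumes "1 \<le> p"
    and "\<mu>0 = arclength_measure (Gamma_union 0)"
    and "\<mu>1 = arclength_measure (Gamma_union 1)"
  shows "(\<exists>!\<pi>. optimal_coupling \<mu>0 \<mu>1 \<pi>) \<and>
    (\<forall>\<mu>. displacement_interpolation \<mu>0 \<mu>1 \<mu> \<longrightarrow>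
        poincare_const p \<mu>0 < \<top> \<and> talagrand_const \<mu>0 < \<top> \<and>
        poincare_const p \<mu>1 < \<top> \<and> talagrand_const \<mu>1 < \<top> \<and>
        (\<forall>t. 0 < t \<and> t < 1 \<longrightarrow>
          poincare_const p (\<mu> t) = \<top> \<and> talagrand_const (\<mu> t) = \<top>)) \<and>
    (2 \<le> CARD('n::finite) \<longrightarrow>
      (\<exists>(\<nu>0 :: (real^'n) measure) \<nu>1 \<nu>.
        prob_space \<nu>0 \<and> sets \<nu>0 = sets borel \<and>
        prob_space \<nu>1 \<and> sets \<nu>1 = sets borel \<and>
        displacement_interpolation \<nu>0 \<nu>1 \<nu> \<and>
        poincare_const p \<nu>0 < \<top> \<and> talagrand_const \<nu>0 < \<top> \<and>
        poincare_const p \<nu>1 < \<top> \<and> talagrand_const \<nu>1 < \<top> \<and>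
        (\<forall>t. 0 < t \<and> t < 1 \<longrightarrow>
          poincare_const p (\<nu> t) = \<top> \<and> talagrand_const (\<nu> t) = \<top>)))"
proof (intro conjI impI)
  let ?e1 = "axis 1 1 :: real^2" and ?e2 = "axis 2 1 :: real^2"
  interpret P: orthonormal_pair ?e1 ?e2
    by unfold_locales (simp_all add: inner_axis_axis)
  have vec: "vector [a, b] = a *\<^sub>R ?e1 + b *\<^sub>R ?e2" for a b
    by (simp add: vec_eq_iff forall_2 axis_def)
  have \<mu>: "\<mu>0 = P.\<mu>0" "\<mu>1 = P.\<mu>1"
    unfolding assms P.arclength_measure_eq[symmetric] Gamma_union_def Gamma_plus_def Gamma_minus_def vec
    by simp_all
  show "\<exists>!\<pi>. optimal_coupling \<mu>0 \<mu>1 \<pi>"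
    unfolding \<mu> P.optimal_coupling_iff by simp
  show "\<forall>\<mu>. displacement_interpolation \<mu>0 \<mu>1 \<mu> \<longrightarrow>
        poincare_const p \<mu>0 < \<top> \<and> talagrand_const \<mu>0 < \<top> \<and>
        poincare_const p \<mu>1 < \<top> \<and> talagrand_const \<mu>1 < \<top> \<and>
        (\<forall>t. 0 < t \<and> t < 1 \<longrightarrow>
          poincare_const p (\<mu> t) = \<top> \<and> talagrand_const (\<mu> t) = \<top>)"
    unfolding \<mu> using P.propagation_fails[OF assms(1)] by blast
  assume "2 \<le> CARD('n)"
  then have "\<not> card (UNIV :: 'n set) \<le> Suc 0" by simp
  \<comment> \<open>Two distinct axes span a copy of the plane, in which the same example
    lives.\<close>
  then obtain i j :: 'n where "i \<noteq> j"
    by (auto simp: card_le_Suc0_iff_eq)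
  then interpret Q: orthonormal_pair "axis i 1 :: real^'n" "axis j 1"
    by unfold_locales (simp_all add: inner_axis_axis)
  obtain \<nu> where \<nu>: "displacement_interpolation Q.\<mu>0 Q.\<mu>1 \<nu>"
    using Q.displacement_interpolation_exists by blast
  show "\<exists>(\<nu>0 :: (real^'n) measure) \<nu>1 \<nu>.
        prob_space \<nu>0 \<and> sets \<nu>0 = sets borel \<and>
        prob_space \<nu>1 \<and> sets \<nu>1 = sets borel \<and>
        displacement_interpolation \<nu>0 \<nu>1 \<nu> \<and>
        poincare_const p \<nu>0 < \<top> \<and> talagrand_const \<nu>0 < \<top> \<and>
        poincare_const p \<nu>1 < \<top> \<and> talagrand_const \<nu>1 < \<top> \<and>
        (\<forall>t. 0 < t \<and> t < 1 \<longrightarrow>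
          poincare_const p (\<nu> t) = \<top> \<and> talagrand_const (\<nu> t) = \<top>)"
    using Q.prob_space_\<mu> \<nu> Q.propagation_fails[OF assms(1) \<nu>]
    by (intro exI[of _ Q.\<mu>0] exI[of _ Q.\<mu>1] exI[of _ \<nu>]) blast
qed

end
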